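(* Let $X$ be an infinite $\mathsf{T}_1$ almost Lindelöf topological space and let $\kappa$ be an uncountable cardinal. Then $$\mathbf{1}_{\mathbb{C}(\kappa)}\Vdash \text{``ONE has no winning strategy in the game } \mathsf{G}_1^{\omega}(\mathcal{O},\overline{\mathcal{O}}) \text{ on } \check{X}\text{.''}$$
   Context: $\mathbb{C}(\kappa)$ is the partially ordered set for adding $\kappa$ Cohen reals: its elements are the finite functions $p$ with domain a subset of $\kappa\times\omega$ and values in $\omega$, ordered by $p<q$ if $q\subset p$; $\mathbf{1}_{\mathbb{C}(\kappa)}$ is its largest element. The ground model satisfies $\mathsf{ZFC}$. A ground model space $(X,\tau)$ is regarded in the extension as the set $X$ with the topology having $\tau$ as a base; this space is denoted $\check{X}$ in the forcing language. A space $X$ is almost Lindelöf if for each open cover $\mathcal{U}$ of $X$ there is a countable $\mathcal{V}\subseteq\mathcal{U}$ such that $\{\overline{V}:V\in\mathcal{V}\}$ covers $X$ ($\overline{V}$ is the closure of $V$). $\mathcal{O}$ is the collection of all open covers of a space; $\overline{\mathcal{O}}$ is the collection of families $\mathcal{U}$ of open subsets of the space for which $\{\overline{U}:U\in\mathcal{U}\}$ covers the space. The game $\mathsf{G}_1^{\omega}(\mathcal{A},\mathcal{B})$: players ONE and TWO play an inning for each $n\in\omega$. In inning $n$ ONE first selects $O_n\in\mathcal{A}$, then TWO responds with $T_n\in O_n$. TWO wins the play if $\{T_n:n\in\omega\}\in\mathcal{B}$; otherwise ONE wins. A strategy of a player prescribes that player's next move as a function of the opponent's moves so far; it is winning if every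 play in which the player follows it is won by that player. *)

theory Defs
  imports "HOL-Analysis.Analysis"
begin

section \<open>The forcing relation\<close>

text \<open>
  A notion of forcing is a relation \<open>P\<close>, with \<open>(q, p) \<in> P\<close> meaning \<open>q \<le> p\<close> (\<open>q\<close> is stronger than
  \<open>p\<close>); its conditions are the elements of \<open>Field P\<close>. The ground model is the HOL universe itself.

  A sentence of the forcing language is identified with the function that tells, for each notion
  of forcing, which conditions force it, so the connectives below are the clauses of the usual
  recursive definition of the forcing relation.

  The forcing language is many-sorted. Points of the ground model space and natural numbers are
  treated as urelements and name themselves. A name of a set of objects of some sort is, as usual,
  a set of pairs consisting of a name of that sort and a condition. Every element of the generic
  extension that is of one of the sorts considered (sets of points, sets of those, and so on)
  has such a name, so that a quantifier over the names of a sort is a quantifier over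
  all the objects of that sort in the generic extension.
\<close>

type_synonym 'p sentence = "'p rel \<Rightarrow> 'p \<Rightarrow> bool"

definition forces :: "'p rel \<Rightarrow> 'p \<Rightarrow> 'p sentence \<Rightarrow> bool" where
  "forces P p \<phi> \<longleftrightarrow> \<phi> P p"

definition fAnd :: "'p sentence \<Rightarrow> 'p sentence \<Rightarrow> 'p sentence"  (infixr "\<^bold>\<and>" 35) where
  "(\<phi> \<^bold>\<and> \<psi>) = (\<lambda>P p. \<phi> P p \<and> \<psi> P p)"

definition fNot :: "'p sentence \<Rightarrow> 'p sentence"  ("\<^bold>\<not> _" [40] 40) where
  "(\<^bold>\<not> \<phi>) = (\<lambda>P p. \<forall>q. (q, p) \<in> P \<longrightarrow> \<not> \<phi> P q)"

definition fImp :: "'p sentence \<Rightarrow> 'p sentence \<Rightarrow> 'p sentence"  (infixr "\<^bold>\<longrightarrow>" 25) where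
  "(\<phi> \<^bold>\<longrightarrow> \<psi>) = (\<^bold>\<not> (\<phi> \<^bold>\<and> \<^bold>\<not> \<psi>))"

definition fIff :: "'p sentence \<Rightarrow> 'p sentence \<Rightarrow> 'p sentence"  (infixr "\<^bold>\<longleftrightarrow>" 25) where
  "(\<phi> \<^bold>\<longleftrightarrow> \<psi>) = ((\<phi> \<^bold>\<longrightarrow> \<psi>) \<^bold>\<and> (\<psi> \<^bold>\<longrightarrow> \<phi>))"

definition fAll :: "('n \<Rightarrow> 'p sentence) \<Rightarrow> 'p sentence"  (binder "\<^bold>\<forall>" 10) where
  "fAll \<phi> = (\<lambda>P p. \<forall>x. \<phi> x P p)"

definition fEx :: "('n \<Rightarrow> 'p sentence) \<Rightarrow> 'p sentence"  (binder "\<^bold>\<exists>" 10) where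
  "fEx \<phi> = (\<lambda>P p. \<forall>q. (q, p) \<in> P \<longrightarrow> (\<exists>r. (r, q) \<in> P \<and> (\<exists>x. \<phi> x P r)))"

text \<open>Statements about urelements only, such as \<open>m < n\<close> for natural numbers.\<close>

definition fGround :: "bool \<Rightarrow> 'p sentence" where
  "fGround b = (\<lambda>P p. b)"

type_synonym ('n, 'p) name = "('n \<times> 'p) set"

text \<open>
  Atomic sentences: \<open>a \<in> B\<close> is forced by \<open>p\<close> iff the set of all \<open>r\<close> such that \<open>r \<le> s\<close> and \<open>r\<close> forces
  \<open>a = b\<close>, for some \<open>(b, s) \<in> B\<close>, is dense below \<open>p\<close>. The argument \<open>E\<close> is equality of the sort of the
  elements, so the recursion on names is a recursion on sorts.
\<close>

definition fMem ::
  "('n \<Rightarrow> 'n \<Rightarrow> 'p sentence) \<Rightarrow> 'n \<Rightarrow> ('n, 'p) name \<Rightarrow> 'p sentence" where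
  "fMem E a B = (\<lambda>P p. \<forall>q. (q, p) \<in> P \<longrightarrow>
     (\<exists>r. (r, q) \<in> P \<and> (\<exists>b s. (b, s) \<in> B \<and> (r, s) \<in> P \<and> E a b P r)))"

definition fSetEq ::
  "('n \<Rightarrow> 'n \<Rightarrow> 'p sentence) \<Rightarrow> ('n, 'p) name \<Rightarrow> ('n, 'p) name \<Rightarrow> 'p sentence" where
  "fSetEq E A B = (\<lambda>P p.
     (\<forall>a s q. (a, s) \<in> A \<and> (q, s) \<in> P \<and> (q, p) \<in> P \<longrightarrow> fMem E a B P q) \<and>
     (\<forall>b s q. (b, s) \<in> B \<and> (q, s) \<in> P \<and> (q, p) \<in> P \<longrightarrow> fMem E b A P q))"

definition fPairEq ::
  "('m \<Rightarrow> 'm \<Rightarrow> 'p sentence) \<Rightarrow> ('n \<Rightarrow> 'n \<Rightarrow> 'p sentence) \<Rightarrow> 'm \<times> 'n \<Rightarrow> 'm \<times> 'n \<Rightarrow> 'p sentence" where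
  "fPairEq E F x y = (E (fst x) (fst y) \<^bold>\<and> F (snd x) (snd y))"

definition fUrEq :: "'u \<Rightarrow> 'u \<Rightarrow> 'p sentence" where
  "fUrEq x y = fGround (x = y)"

text \<open>
  The canonical name of a ground model set \<open>S\<close>, given the canonical names of its elements;
  \<open>one\<close> is the largest condition.
\<close>

definition check :: "'p \<Rightarrow> 'n set \<Rightarrow> ('n, 'p) name" where
  "check one S = (\<lambda>x. (x, one)) ` S"


section \<open>Sorts\<close>

text \<open>
  Names of sets of points, of families of such sets, of sequences of such sets (a sequence is a set
  of pairs), and of functions from sequences of sets to families of sets.
\<close>

type_synonym ('a, 'p) pts = "('a, 'p) name"
type_synonym ('a, 'p) fam = "(('a, 'p) pts, 'p) name"
type_synonym ('a, 'p) seq = "(nat \<times> ('a, 'p) pts, 'p) name"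
type_synonym ('a, 'p) strat = "(('a, 'p) seq \<times> ('a, 'p) fam, 'p) name"

abbreviation eq_pts :: "('a, 'p) pts \<Rightarrow> ('a, 'p) pts \<Rightarrow> 'p sentence" where
  "eq_pts \<equiv> fSetEq fUrEq"

abbreviation eq_fam :: "('a, 'p) fam \<Rightarrow> ('a, 'p) fam \<Rightarrow> 'p sentence" where
  "eq_fam \<equiv> fSetEq eq_pts"

abbreviation eq_seq :: "('a, 'p) seq \<Rightarrow> ('a, 'p) seq \<Rightarrow> 'p sentence" where
  "eq_seq \<equiv> fSetEq (fPairEq fUrEq eq_pts)"

abbreviation mem_pts :: "'a \<Rightarrow> ('a, 'p) pts \<Rightarrow> 'p sentence" where
  "mem_pts \<equiv> fMem fUrEq"

abbreviation mem_fam :: "('a, 'p) pts \<Rightarrow> ('a, 'p) fam \<Rightarrow> 'p sentence" where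
  "mem_fam \<equiv> fMem eq_pts"

abbreviation mem_seq :: "nat \<times> ('a, 'p) pts \<Rightarrow> ('a, 'p) seq \<Rightarrow> 'p sentence" where
  "mem_seq \<equiv> fMem (fPairEq fUrEq eq_pts)"

abbreviation mem_strat :: "('a, 'p) seq \<times> ('a, 'p) fam \<Rightarrow> ('a, 'p) strat \<Rightarrow> 'p sentence" where
  "mem_strat \<equiv> fMem (fPairEq eq_seq eq_fam)"


section \<open>Formulas about a space and its game\<close>

text \<open>Here \<open>S\<close> names the set of points of the space and \<open>B\<close> names a base of its topology.\<close>

definition is_open :: "('a, 'p) fam \<Rightarrow> ('a, 'p) pts \<Rightarrow> 'p sentence" where
  "is_open B A =
     (\<^bold>\<forall>x. mem_pts x A \<^bold>\<longrightarrow>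
        (\<^bold>\<exists>U. mem_fam U B \<^bold>\<and> mem_pts x U \<^bold>\<and> (\<^bold>\<forall>y. mem_pts y U \<^bold>\<longrightarrow> mem_pts y A)))"

definition in_closure :: "('a, 'p) pts \<Rightarrow> ('a, 'p) fam \<Rightarrow> 'a \<Rightarrow> ('a, 'p) pts \<Rightarrow> 'p sentence" where
  "in_closure S B x A =
     (mem_pts x S \<^bold>\<and>
      (\<^bold>\<forall>U. is_open B U \<^bold>\<and> mem_pts x U \<^bold>\<longrightarrow> (\<^bold>\<exists>y. mem_pts y U \<^bold>\<and> mem_pts y A)))"

text \<open>The collections \<open>\<O>\<close> (open covers) and \<open>\<O>\<close>-bar (open families whose closures cover).\<close>

definition open_cover :: "('a, 'p) pts \<Rightarrow> ('a, 'p) fam \<Rightarrow> ('a, 'p) fam \<Rightarrow> 'p sentence" where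
  "open_cover S B C =
     ((\<^bold>\<forall>U. mem_fam U C \<^bold>\<longrightarrow> is_open B U) \<^bold>\<and>
      (\<^bold>\<forall>x. mem_pts x S \<^bold>\<longrightarrow> (\<^bold>\<exists>U. mem_fam U C \<^bold>\<and> mem_pts x U)))"

definition closure_cover :: "('a, 'p) pts \<Rightarrow> ('a, 'p) fam \<Rightarrow> ('a, 'p) fam \<Rightarrow> 'p sentence" where
  "closure_cover S B C =
     ((\<^bold>\<forall>U. mem_fam U C \<^bold>\<longrightarrow> is_open B U) \<^bold>\<and>
      (\<^bold>\<forall>x. mem_pts x S \<^bold>\<longrightarrow> (\<^bold>\<exists>U. mem_fam U C \<^bold>\<and> in_closure S B x U)))"

text \<open>\<open>s\<close> is a function with domain \<open>D\<close>, where \<open>D\<close> is \<open>\<omega>\<close> or an element of \<open>\<omega>\<close>.\<close>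

definition is_seq :: "nat set \<Rightarrow> ('a, 'p) seq \<Rightarrow> 'p sentence" where
  "is_seq D s =
     ((\<^bold>\<forall>m. \<^bold>\<forall>A. mem_seq (m, A) s \<^bold>\<longrightarrow> fGround (m \<in> D)) \<^bold>\<and>
      (\<^bold>\<forall>m. fGround (m \<in> D) \<^bold>\<longrightarrow> (\<^bold>\<exists>A. mem_seq (m, A) s)) \<^bold>\<and>
      (\<^bold>\<forall>m. \<^bold>\<forall>A. \<^bold>\<forall>A'. mem_seq (m, A) s \<^bold>\<and> mem_seq (m, A') s \<^bold>\<longrightarrow> eq_pts A A'))"

text \<open>\<open>s\<close> is a finite sequence of open sets, i.e. a list of moves of TWO.\<close>

definition is_position :: "('a, 'p) fam \<Rightarrow> ('a, 'p) seq \<Rightarrow> 'p sentence" where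
  "is_position B s =
     ((\<^bold>\<exists>n. is_seq {..<n} s) \<^bold>\<and> (\<^bold>\<forall>m. \<^bold>\<forall>A. mem_seq (m, A) s \<^bold>\<longrightarrow> is_open B A))"

definition is_strategy_ONE :: "('a, 'p) pts \<Rightarrow> ('a, 'p) fam \<Rightarrow> ('a, 'p) strat \<Rightarrow> 'p sentence" where
  "is_strategy_ONE S B F =
     ((\<^bold>\<forall>s. \<^bold>\<forall>C. mem_strat (s, C) F \<^bold>\<longrightarrow> is_position B s \<^bold>\<and> open_cover S B C) \<^bold>\<and>
      (\<^bold>\<forall>s. is_position B s \<^bold>\<longrightarrow> (\<^bold>\<exists>C. mem_strat (s, C) F)) \<^bold>\<and>
      (\<^bold>\<forall>s. \<^bold>\<forall>C. \<^bold>\<forall>C'. mem_strat (s, C) F \<^bold>\<and> mem_strat (s, C') F \<^bold>\<longrightarrow> eq_fam C C'))"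

definition is_restriction :: "('a, 'p) seq \<Rightarrow> nat \<Rightarrow> ('a, 'p) seq \<Rightarrow> 'p sentence" where
  "is_restriction T n s =
     (\<^bold>\<forall>m. \<^bold>\<forall>A. mem_seq (m, A) s \<^bold>\<longleftrightarrow> mem_seq (m, A) T \<^bold>\<and> fGround (m < n))"

text \<open>
  \<open>T\<close> is the sequence of TWO's moves in a play in which ONE follows \<open>F\<close>: in inning \<open>n\<close>, ONE selects
  \<open>C = F (T\<restriction>n)\<close> and TWO responds with \<open>T n \<in> C\<close>.
\<close>

definition is_play :: "('a, 'p) strat \<Rightarrow> ('a, 'p) seq \<Rightarrow> 'p sentence" where
  "is_play F T =
     (is_seq UNIV T \<^bold>\<and>
      (\<^bold>\<forall>n. \<^bold>\<exists>s. \<^bold>\<exists>C. \<^bold>\<exists>A. is_restriction T n s \<^bold>\<and> mem_strat (s, C) F \<^bold>\<and>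
         mem_seq (n, A) T \<^bold>\<and> mem_fam A C))"

definition TWO_wins :: "('a, 'p) pts \<Rightarrow> ('a, 'p) fam \<Rightarrow> ('a, 'p) seq \<Rightarrow> 'p sentence" where
  "TWO_wins S B T =
     (\<^bold>\<exists>R. (\<^bold>\<forall>A. mem_fam A R \<^bold>\<longleftrightarrow> (\<^bold>\<exists>n. mem_seq (n, A) T)) \<^bold>\<and> closure_cover S B R)"

definition ONE_has_winning_strategy :: "('a, 'p) pts \<Rightarrow> ('a, 'p) fam \<Rightarrow> 'p sentence" where
  "ONE_has_winning_strategy S B =
     (\<^bold>\<exists>F. is_strategy_ONE S B F \<^bold>\<and> (\<^bold>\<forall>T. is_play F T \<^bold>\<longrightarrow> \<^bold>\<not> TWO_wins S B T))"

text \<open>The space \<open>X\<close> in the extension has the ground model topology as a base.\<close>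

definition check_points :: "'p \<Rightarrow> 'a topology \<Rightarrow> ('a, 'p) pts" where
  "check_points one X = check one (topspace X)"

definition check_base :: "'p \<Rightarrow> 'a topology \<Rightarrow> ('a, 'p) fam" where
  "check_base one X = check one (check one ` {U. openin X U})"


section \<open>Cohen forcing and almost Lindelof spaces\<close>

text \<open>
  A cardinal is given in the form used by the library, as a cardinal order \<open>\<kappa>\<close>; its elements are those
  of \<open>Field \<kappa>\<close>.
\<close>

definition cohen_conditions :: "'k rel \<Rightarrow> ('k \<times> nat \<rightharpoonup> nat) set" where
  "cohen_conditions \<kappa> = {p. finite (dom p) \<and> dom p \<subseteq> Field \<kappa> \<times> UNIV}"

definition cohen :: "'k rel \<Rightarrow> ('k \<times> nat \<rightharpoonup> nat) rel" where
  "cohen \<kappa> = {(p, q). p \<in> cohen_conditions \<kappa> \<and> q \<in> cohen_conditions \<kappa> \<and> q \<subseteq>\<^sub>m p}"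

definition cohen_one :: "'k \<times> nat \<rightharpoonup> nat" where
  "cohen_one = Map.empty"

definition almost_Lindelof_space :: "'a topology \<Rightarrow> bool" where
  "almost_Lindelof_space X \<longleftrightarrow>
     (\<forall>\<U>. (\<forall>U\<in>\<U>. openin X U) \<and> \<Union>\<U> = topspace X \<longrightarrow>
       (\<exists>\<V>\<subseteq>\<U>. countable \<V> \<and> (\<Union>V\<in>\<V>. X closure_of V) = topspace X))"

end

theory Submission
  imports Defs
begin

text \<open>
  Let \<open>p\<close> force that \<open>F\<close> is a strategy of ONE. If \<open>q \<le> p\<close> forces that a list \<open>As\<close> of names is a partial
  play of TWO against \<open>F\<close>, then the ground model open sets that some \<open>r \<le> q\<close> forces to be included in a
  legal next move \<open>A\<close> cover \<open>X\<close>, so countably many pairs \<open>(r, A)\<close> suffice for the closures to cover \<open>X\<close>.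
  Closing off gives a countable set \<open>K \<subseteq> \<kappa>\<close> and a countable set of partial plays such that these pairs
  can be found there whenever \<open>q\<close> has its support in \<open>K\<close>. Now TWO plays generically: the Cohen real at
  a coordinate \<open>\<alpha> \<in> \<kappa> - K\<close> picks the moves from this countable tree. Given a point \<open>x\<close> and a condition
  \<open>q\<close>, restrict \<open>q\<close> to \<open>K\<close>, choose a pair \<open>(r, A)\<close> for the restriction such that \<open>x\<close> is in the closure of \<open>A\<close>,
  and note that \<open>r\<close> is compatible with \<open>q\<close> and that the next undecided digit at \<open>\<alpha>\<close> can be made to pick
  \<open>(r, A)\<close>. Hence the closures of TWO's moves cover \<open>X\<close>.
\<close>

section \<open>Monotonicity and density of the forcing relation\<close>

section \<open>The forcing relation\<close>

text \<open>The two standard properties of forcing: stronger conditions force more, and what is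
  forced densely below a condition is forced by it. A sentence is an arbitrary predicate of
  conditions, so both are established formula by formula.\<close>

definition persistent :: "'p rel \<Rightarrow> 'p sentence \<Rightarrow> bool" where
  "persistent P \<phi> \<longleftrightarrow>
     (\<forall>p q. (q, p) \<in> P \<longrightarrow> \<phi> P p \<longrightarrow> \<phi> P q) \<and>
     (\<forall>p\<in>Field P. (\<forall>q. (q, p) \<in> P \<longrightarrow> (\<exists>r. (r, q) \<in> P \<and> \<phi> P r)) \<longrightarrow> \<phi> P p)"

lemma persistentI:
  assumes "\<And>p q. \<phi> P p \<Longrightarrow> (q, p) \<in> P \<Longrightarrow> \<phi> P q"
    and "\<And>p. p \<in> Field P \<Longrightarrow> \<forall>q. (q, p) \<in> P \<longrightarrow> (\<exists>r. (r, q) \<in> P \<and> \<phi> P r) \<Longrightarrow> \<phi> P p"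
  shows "persistent P \<phi>"
  using assms unfolding persistent_def by blast

lemma persistent_mono: "persistent P \<phi> \<Longrightarrow> \<phi> P p \<Longrightarrow> (q, p) \<in> P \<Longrightarrow> \<phi> P q"
  unfolding persistent_def by blast

lemma persistent_dense:
  "persistent P \<phi> \<Longrightarrow> p \<in> Field P \<Longrightarrow> (\<And>q. (q, p) \<in> P \<Longrightarrow> \<exists>r. (r, q) \<in> P \<and> \<phi> P r) \<Longrightarrow> \<phi> P p"
  unfolding persistent_def by blast

lemma fAnd_iff: "(\<phi> \<^bold>\<and> \<psi>) P p \<longleftrightarrow> \<phi> P p \<and> \<psi> P p"
  by (simp add: fAnd_def)

lemma fAndI: "\<phi> P p \<Longrightarrow> \<psi> P p \<Longrightarrow> (\<phi> \<^bold>\<and> \<psi>) P p"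
  and fAndD1: "(\<phi> \<^bold>\<and> \<psi>) P p \<Longrightarrow> \<phi> P p"
  and fAndD2: "(\<phi> \<^bold>\<and> \<psi>) P p \<Longrightarrow> \<psi> P p"
  by (simp_all add: fAnd_def)

lemma fAll_iff: "fAll \<phi> P p \<longleftrightarrow> (\<forall>x. \<phi> x P p)"
  by (simp add: fAll_def)

lemma fAllI: "(\<And>x. \<phi> x P p) \<Longrightarrow> fAll \<phi> P p"
  by (simp add: fAll_def)

lemma fAllD: "fAll \<phi> P p \<Longrightarrow> \<phi> x P p"
  by (simp add: fAll_def)

lemma fGround_iff: "fGround b P p \<longleftrightarrow> b"
  by (simp add: fGround_def)

lemma fUrEq_iff: "fUrEq x y P p \<longleftrightarrow> x = y"
  by (simp add: fUrEq_def fGround_def)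

lemma pair_pts_iff: "fPairEq fUrEq eq_pts (a, b) (c, d) P p \<longleftrightarrow> a = c \<and> eq_pts b d P p"
  unfolding fPairEq_def fAnd_def fst_conv snd_conv fUrEq_iff by (rule refl)

locale forcing_notion =
  fixes P :: "'p rel" and one :: 'p
  assumes P_refl: "p \<in> Field P \<Longrightarrow> (p, p) \<in> P"
    and P_trans: "(r, q) \<in> P \<Longrightarrow> (q, p) \<in> P \<Longrightarrow> (r, p) \<in> P"
    and P_one: "p \<in> Field P \<Longrightarrow> (p, one) \<in> P"
begin

lemma P_field: "(q, p) \<in> P \<Longrightarrow> q \<in> Field P" "(q, p) \<in> P \<Longrightarrow> p \<in> Field P"
  by (auto simp: Field_def)

lemma persistent_fAnd: "persistent P \<phi> \<Longrightarrow> persistent P \<psi> \<Longrightarrow> persistent P (\<phi> \<^bold>\<and> \<psi>)"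
  unfolding persistent_def fAnd_def by blast

lemma persistent_fNot: "persistent P \<phi> \<Longrightarrow> persistent P (\<^bold>\<not> \<phi>)"
  unfolding persistent_def fNot_def using P_trans by meson

lemma persistent_fImp: "persistent P \<phi> \<Longrightarrow> persistent P \<psi> \<Longrightarrow> persistent P (\<phi> \<^bold>\<longrightarrow> \<psi>)"
  unfolding fImp_def by (intro persistent_fNot persistent_fAnd)

lemma persistent_fIff: "persistent P \<phi> \<Longrightarrow> persistent P \<psi> \<Longrightarrow> persistent P (\<phi> \<^bold>\<longleftrightarrow> \<psi>)"
  unfolding fIff_def by (intro persistent_fImp persistent_fAnd)

lemma persistent_fAll: "(\<And>x. persistent P (\<phi> x)) \<Longrightarrow> persistent P (fAll \<phi>)"
  unfolding persistent_def fAll_def by blast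

lemma persistent_fEx: "persistent P (fEx \<phi>)"
  unfolding persistent_def fEx_def using P_trans P_refl P_field by meson

lemma persistent_fGround: "persistent P (fGround b)"
  unfolding persistent_def fGround_def using P_refl by blast

lemma persistent_fUrEq: "persistent P (fUrEq x y)"
  unfolding fUrEq_def by (rule persistent_fGround)

text \<open>Forced membership is itself a density statement below the condition, which makes it
  persistent for every \<open>E\<close>.\<close>

lemma persistent_fMem: "persistent P (fMem E a B)"
proof -
  define D where "D r \<longleftrightarrow> (\<exists>b s. (b, s) \<in> B \<and> (r, s) \<in> P \<and> E a b P r)" for r
  have eq: "fMem E a B P p \<longleftrightarrow> (\<forall>q. (q, p) \<in> P \<longrightarrow> (\<exists>r. (r, q) \<in> P \<and> D r))" for p
    by (simp add: fMem_def D_def)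
  show ?thesis
    unfolding persistent_def eq using P_trans P_refl P_field by meson
qed

text \<open>Both clauses range over all stronger conditions and end in a membership, which is
  persistent for every \<open>E\<close>; one proof thus serves all sorts.\<close>

lemma persistent_fSetEq: "persistent P (fSetEq E A B)"
proof -
  have 1: "fSetEq E A B P q" if "fSetEq E A B P p" "(q, p) \<in> P" for p q
    using that unfolding fSetEq_def by (meson P_trans)
  have 2: "fSetEq E A B P p"
    if p: "p \<in> Field P" and d: "\<forall>q. (q, p) \<in> P \<longrightarrow> (\<exists>r. (r, q) \<in> P \<and> fSetEq E A B P r)" for p
    unfolding fSetEq_def
  proof (intro conjI allI impI; elim conjE)
    fix a s q assume a: "(a, s) \<in> A" "(q, s) \<in> P" "(q, p) \<in> P"
    show "fMem E a B P q"
    proof (rule persistent_dense[OF persistent_fMem])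
      show "q \<in> Field P" using a P_field by blast
      fix r assume "(r, q) \<in> P"
      then obtain t where t: "(t, r) \<in> P" "fSetEq E A B P t"
        using d a by (meson P_trans)
      then have "fMem E a B P t"
        using a \<open>(r, q) \<in> P\<close> unfolding fSetEq_def by (meson P_trans P_refl P_field)
      with t show "\<exists>r'. (r', r) \<in> P \<and> fMem E a B P r'" by blast
    qed
  next
    fix a s q assume a: "(a, s) \<in> B" "(q, s) \<in> P" "(q, p) \<in> P"
    show "fMem E a A P q"
    proof (rule persistent_dense[OF persistent_fMem])
      show "q \<in> Field P" using a P_field by blast
      fix r assume "(r, q) \<in> P"
      then obtain t where t: "(t, r) \<in> P" "fSetEq E A B P t"
        using d a by (meson P_trans)
      then have "fMem E a A P t"
        using a \<open>(r, q) \<in> P\<close> unfolding fSetEq_def by (meson P_trans P_refl P_field)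
      with t show "\<exists>r'. (r', r) \<in> P \<and> fMem E a A P r'" by blast
    qed
  qed
  show ?thesis by (rule persistentI[where \<phi> = "fSetEq E A B", OF 1 2])
qed

lemmas persistent_intros =
  persistent_fAnd persistent_fNot persistent_fImp persistent_fIff persistent_fAll
  persistent_fEx persistent_fGround persistent_fMem persistent_fSetEq

section \<open>Rules for implication, existence and membership\<close>

lemma fImpI:
  "p \<in> Field P \<Longrightarrow> (\<And>q. (q, p) \<in> P \<Longrightarrow> \<phi> P q \<Longrightarrow> \<psi> P q) \<Longrightarrow> (\<phi> \<^bold>\<longrightarrow> \<psi>) P p"
  unfolding fImp_def fNot_def fAnd_def using P_refl P_field by blast

text \<open>An implication is coded by negation and conjunction, so it yields \<open>\<psi>\<close>
  only densely below \<open>q\<close>; the density property of \<open>\<psi>\<close> lifts this to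
  \<open>q\<close> itself.\<close>

lemma fImpD:
  assumes "persistent P \<phi>" "persistent P \<psi>" "(\<phi> \<^bold>\<longrightarrow> \<psi>) P p" "(q, p) \<in> P" "\<phi> P q"
  shows "\<psi> P q"
proof (rule persistent_dense[OF assms(2)])
  show "q \<in> Field P" using assms P_field by blast
  fix r assume "(r, q) \<in> P"
  moreover have "\<phi> P r" by (rule persistent_mono[OF assms(1,5) \<open>(r, q) \<in> P\<close>])
  moreover have "(r, p) \<in> P" using P_trans[OF \<open>(r, q) \<in> P\<close> assms(4)] .
  ultimately show "\<exists>t. (t, r) \<in> P \<and> \<psi> P t"
    using assms(3) unfolding fImp_def fNot_def fAnd_def by blast
qed

lemma fIffI:
  "p \<in> Field P \<Longrightarrow> (\<And>q. (q, p) \<in> P \<Longrightarrow> \<phi> P q \<longleftrightarrow> \<psi> P q) \<Longrightarrow> (\<phi> \<^bold>\<longleftrightarrow> \<psi>) P p"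
  unfolding fIff_def fAnd_iff using fImpI[of p \<phi> \<psi>] fImpI[of p \<psi> \<phi>] by blast


lemma fEx_dense:
  "(\<And>q. (q, p) \<in> P \<Longrightarrow> \<exists>r x. (r, q) \<in> P \<and> \<phi> x P r) \<Longrightarrow> fEx \<phi> P p"
  unfolding fEx_def by blast

lemma fExI: "persistent P (\<phi> x) \<Longrightarrow> \<phi> x P p \<Longrightarrow> fEx \<phi> P p"
  by (rule fEx_dense) (blast intro: persistent_mono[of P "\<phi> x"] P_refl P_field)

lemma fExD: "fEx \<phi> P p \<Longrightarrow> (q, p) \<in> P \<Longrightarrow> \<exists>r x. (r, q) \<in> P \<and> \<phi> x P r"
  unfolding fEx_def by blast

lemma fMemD: "fMem E a B P p \<Longrightarrow> (q, p) \<in> P \<Longrightarrow> \<exists>r b s. (r, q) \<in> P \<and> (b, s) \<in> B \<and> (r, s) \<in> P \<and> E a b P r"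
  unfolding fMem_def by blast

lemma fMemI:
  "(\<And>q. (q, p) \<in> P \<Longrightarrow> \<exists>r b s. (r, q) \<in> P \<and> (b, s) \<in> B \<and> (r, s) \<in> P \<and> E a b P r) \<Longrightarrow> fMem E a B P p"
  unfolding fMem_def by blast

lemma fMem_elemI:
  assumes "(b, s) \<in> B" "(p, s) \<in> P" "persistent P (E a b)" "E a b P p"
  shows "fMem E a B P p"
proof (rule fMemI)
  fix q assume "(q, p) \<in> P"
  then show "\<exists>r b s. (r, q) \<in> P \<and> (b, s) \<in> B \<and> (r, s) \<in> P \<and> E a b P r"
    using assms P_trans P_refl P_field persistent_mono by meson
qed

section \<open>Membership in and equality of names of sets of points\<close>

lemma mem_pts_elemI: "(x, s) \<in> A \<Longrightarrow> (p, s) \<in> P \<Longrightarrow> mem_pts x A P p"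
  by (rule fMem_elemI[OF _ _ persistent_fUrEq]) (auto simp: fUrEq_iff)

text \<open>Points are urelements and a canonical name carries only the largest condition, so every
  condition decides this membership.\<close>

lemma mem_pts_check: "p \<in> Field P \<Longrightarrow> mem_pts x (check one S) P p \<longleftrightarrow> x \<in> S"
  using fMemD[of fUrEq x "check one S" p p] P_refl[of p]
  by (auto simp: check_def fUrEq_iff intro!: mem_pts_elemI P_one)

text \<open>Extensionality. In this form reflexivity, transitivity and the substitution of equals in
  memberships are immediate.\<close>

lemma eq_pts_iff:
  assumes "p \<in> Field P"
  shows "eq_pts A B P p \<longleftrightarrow> (\<forall>q x. (q, p) \<in> P \<longrightarrow> (mem_pts x A P q \<longleftrightarrow> mem_pts x B P q))"
proof
  have imp: "mem_pts x B P q" if *: "eq_pts A B P p" "(q, p) \<in> P" "mem_pts x A P q"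
    for A B :: "('b, 'p) pts" and q x
  proof (rule persistent_dense[OF persistent_fMem])
    show "q \<in> Field P" using * P_field by blast
    fix r assume "(r, q) \<in> P"
    then obtain t s where "(t, r) \<in> P" "(x, s) \<in> A" "(t, s) \<in> P"
      using *(3) by (auto dest!: fMemD simp: fUrEq_iff)
    then show "\<exists>t. (t, r) \<in> P \<and> mem_pts x B P t"
      using *(1,2) \<open>(r, q) \<in> P\<close> P_trans unfolding fSetEq_def by meson
  qed
  assume eq: "eq_pts A B P p"
  then have "eq_pts B A P p" by (auto simp: fSetEq_def)
  then show "\<forall>q x. (q, p) \<in> P \<longrightarrow> (mem_pts x A P q \<longleftrightarrow> mem_pts x B P q)"
    using imp[OF eq] imp[of B A] by metis
next
  assume "\<forall>q x. (q, p) \<in> P \<longrightarrow> (mem_pts x A P q \<longleftrightarrow> mem_pts x B P q)"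
  then show "eq_pts A B P p" unfolding fSetEq_def using mem_pts_elemI by metis
qed

lemma eq_pts_refl: "p \<in> Field P \<Longrightarrow> eq_pts A A P p"
  by (simp add: eq_pts_iff)

lemma eq_pts_sym: "eq_pts A B P p \<Longrightarrow> eq_pts B A P p"
  by (auto simp: fSetEq_def)

lemma eq_pts_trans: "p \<in> Field P \<Longrightarrow> eq_pts A B P p \<Longrightarrow> eq_pts B C P p \<Longrightarrow> eq_pts A C P p"
  by (simp add: eq_pts_iff)

lemma eq_pts_mem: "eq_pts A B P p \<Longrightarrow> (q, p) \<in> P \<Longrightarrow> mem_pts x A P q \<longleftrightarrow> mem_pts x B P q"
  using eq_pts_iff P_field by metis

lemma persistent_pair_pts: "persistent P (fPairEq fUrEq eq_pts a b)"
  unfolding fPairEq_def by (intro persistent_intros persistent_fUrEq)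

lemma mem_seqD:
  assumes "mem_seq (m, A) s P p" "(q, p) \<in> P"
  shows "\<exists>r B t. (r, q) \<in> P \<and> ((m, B), t) \<in> s \<and> (r, t) \<in> P \<and> eq_pts A B P r"
  using fMemD[OF assms] by (fastforce simp only: split_paired_Ex pair_pts_iff)

lemma mem_seq_elemI:
  "((m, B), t) \<in> s \<Longrightarrow> (p, t) \<in> P \<Longrightarrow> eq_pts A B P p \<Longrightarrow> mem_seq (m, A) s P p"
  by (rule fMem_elemI[OF _ _ persistent_pair_pts], assumption+) (simp only: pair_pts_iff simp_thms)

section \<open>Forced openness in terms of ground model open sets\<close>

section \<open>Open sets\<close>

text \<open>A member of the base is, densely, equal to the canonical name of a ground model open
  set, and membership in such a name is decided. This removes all names of open sets except
  \<open>A\<close> from the definition.\<close>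

lemma is_open_iff:
  assumes p: "p \<in> Field P"
  shows "is_open (check_base one X) A P p \<longleftrightarrow>
    (\<forall>q x. (q, p) \<in> P \<longrightarrow> mem_pts x A P q \<longrightarrow>
      (\<exists>r U. (r, q) \<in> P \<and> openin X U \<and> x \<in> U \<and> (\<forall>y\<in>U. mem_pts y A P r)))"
    (is "?L \<longleftrightarrow> ?R")
proof
  assume L: ?L
  show ?R
  proof (intro allI impI)
    fix q x assume q: "(q, p) \<in> P" and x: "mem_pts x A P q"
    have "(mem_pts x A \<^bold>\<longrightarrow> (\<^bold>\<exists>U. mem_fam U (check_base one X) \<^bold>\<and> mem_pts x U \<^bold>\<and>
        (\<^bold>\<forall>y. mem_pts y U \<^bold>\<longrightarrow> mem_pts y A))) P p"
      using L unfolding is_open_def fAll_def ..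
    note ex = fImpD[OF persistent_fMem persistent_fEx this q x]
    have "\<exists>r U. (r, q) \<in> P \<and> (mem_fam U (check_base one X) \<^bold>\<and> mem_pts x U \<^bold>\<and>
        (\<^bold>\<forall>y. mem_pts y U \<^bold>\<longrightarrow> mem_pts y A)) P r"
      by (rule fExD[OF ex P_refl]) (use q P_field in blast)
    then obtain r U where r: "(r, q) \<in> P"
      and U: "mem_fam U (check_base one X) P r" "mem_pts x U P r"
      and sub: "(mem_pts y U \<^bold>\<longrightarrow> mem_pts y A) P r" for y
      unfolding fAnd_iff fAll_iff by blast
    from fMemD[OF U(1) P_refl] r obtain t U0 where t: "(t, r) \<in> P" "openin X U0"
      and eq: "eq_pts U (check one U0) P t"
      by (auto simp: check_base_def check_def P_field)
    have tF: "t \<in> Field P" "(t, t) \<in> P" using t P_field P_refl by auto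
    have "x \<in> U0"
      using persistent_mono[OF persistent_fMem U(2) t(1)]
      by (simp add: eq_pts_mem[OF eq tF(2)] mem_pts_check[OF tF(1)])
    moreover have "mem_pts y A P t" if "y \<in> U0" for y
    proof (rule fImpD[OF persistent_fMem persistent_fMem sub t(1)])
      show "mem_pts y U P t" using that by (simp add: eq_pts_mem[OF eq tF(2)] mem_pts_check[OF tF(1)])
    qed
    ultimately show "\<exists>r U. (r, q) \<in> P \<and> openin X U \<and> x \<in> U \<and> (\<forall>y\<in>U. mem_pts y A P r)"
      using t r P_trans by meson
  qed
next
  assume R: ?R
  show ?L
    unfolding is_open_def
  proof (rule fAllI, rule fImpI[OF p], rule fEx_dense)
    fix x q q' assume q: "(q, p) \<in> P" "mem_pts x A P q" "(q', q) \<in> P"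
    obtain r U where r: "(r, q') \<in> P" "openin X U" "x \<in> U" "\<forall>y\<in>U. mem_pts y A P r"
      using R q P_trans persistent_mono[OF persistent_fMem] by meson
    have rF: "r \<in> Field P" using r P_field by blast
    have "mem_fam (check one U) (check_base one X) P r"
      by (rule fMem_elemI[of _ one])
        (use r(2) rF in \<open>auto simp: check_base_def check_def P_one eq_pts_refl intro: persistent_intros\<close>)
    moreover have "mem_pts x (check one U) P r" using r(3) by (simp add: mem_pts_check[OF rF])
    moreover have "(mem_pts y (check one U) \<^bold>\<longrightarrow> mem_pts y A) P r" for y
    proof (rule fImpI[OF rF])
      fix t assume t: "(t, r) \<in> P" "mem_pts y (check one U) P t"
      then have "y \<in> U" by (simp add: mem_pts_check[OF P_field(1)[OF t(1)]])
      then show "mem_pts y A P t" using r(4) persistent_mono[OF persistent_fMem _ t(1)] by metis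
    qed
    ultimately have "(mem_fam (check one U) (check_base one X) \<^bold>\<and> mem_pts x (check one U) \<^bold>\<and>
        (\<^bold>\<forall>y. mem_pts y (check one U) \<^bold>\<longrightarrow> mem_pts y A)) P r"
      by (simp only: fAnd_iff fAll_iff simp_thms)
    with r(1) show "\<exists>r U. (r, q') \<in> P \<and> (mem_fam U (check_base one X) \<^bold>\<and> mem_pts x U \<^bold>\<and>
        (\<^bold>\<forall>y. mem_pts y U \<^bold>\<longrightarrow> mem_pts y A)) P r"
      by (intro exI conjI)
  qed
qed

lemma persistent_is_open: "persistent P (is_open B A)"
  unfolding is_open_def by (intro persistent_intros)

lemma is_open_cong:
  assumes "p \<in> Field P" "eq_pts A A' P p" "is_open (check_base one X) A P p"
  shows "is_open (check_base one X) A' P p"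
  unfolding is_open_iff[OF assms(1)]
proof (intro allI impI)
  fix q x assume q: "(q, p) \<in> P" and "mem_pts x A' P q"
  then have "mem_pts x A P q" by (simp add: eq_pts_mem[OF assms(2)])
  then obtain r U where r: "(r, q) \<in> P" "openin X U" "x \<in> U" "\<forall>y\<in>U. mem_pts y A P r"
    using assms(3) q unfolding is_open_iff[OF assms(1)] by meson
  then have "\<forall>y\<in>U. mem_pts y A' P r" by (simp add: eq_pts_mem[OF assms(2) P_trans[OF r(1) q]])
  with r show "\<exists>r U. (r, q) \<in> P \<and> openin X U \<and> x \<in> U \<and> (\<forall>y\<in>U. mem_pts y A' P r)" by blast
qed

lemma open_cover_is_open:
  assumes "p \<in> Field P" "open_cover S B C P p" "mem_fam U C P p"
  shows "is_open B U P p"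
proof -
  have "(mem_fam U C \<^bold>\<longrightarrow> is_open B U) P p"
    using assms(2) by (simp add: open_cover_def fAnd_iff fAll_iff)
  from fImpD[OF persistent_fMem persistent_is_open this P_refl[OF assms(1)] assms(3)] show ?thesis .
qed

end

section \<open>Partial plays of TWO and countably many extensions of them\<close>

section \<open>Partial plays\<close>

text \<open>The list lives in the ground model while its entries are names: the length and the
  indices are decided, the moves themselves need not be.\<close>

definition fin_seq :: "'p \<Rightarrow> ('a, 'p) pts list \<Rightarrow> ('a, 'p) seq" where
  "fin_seq one As = {((i, As ! i), one) |i. i < length As}"

locale strategy = forcing_notion P one for P :: "'p rel" and one +
  fixes X :: "'a topology" and F :: "('a, 'p) strat" and p :: 'p
  assumes p_field: "p \<in> Field P"
    and strategy: "is_strategy_ONE (check_points one X) (check_base one X) F P p"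
begin

text \<open>Forced partial plays of TWO against \<open>F\<close>. A witness \<open>C\<close> is
  demanded at \<open>r\<close> itself and not just densely below it, so extending a play may require
  a stronger condition.\<close>

definition legal :: "'p \<Rightarrow> ('a, 'p) pts list \<Rightarrow> bool" where
  "legal r As \<longleftrightarrow> (r, p) \<in> P \<and> (\<forall>i<length As. \<exists>C.
     mem_strat (fin_seq one (take i As), C) F P r \<and> mem_fam (As ! i) C P r)"

lemma legal_Nil: "legal p []"
  by (simp add: legal_def P_refl p_field)

lemma legal_mono: "legal r As \<Longrightarrow> (q, r) \<in> P \<Longrightarrow> legal q As"
  unfolding legal_def by (meson P_trans persistent_mono[OF persistent_fMem])

lemma legal_snoc:
  assumes "legal r As" "mem_strat (fin_seq one As, C) F P r" "mem_fam A C P r"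
  shows "legal r (As @ [A])"
  unfolding legal_def
proof (intro conjI allI impI)
  show "(r, p) \<in> P" using assms(1) legal_def by blast
  fix i assume "i < length (As @ [A])"
  then consider "i < length As" | "i = length As" by fastforce
  then show "\<exists>C. mem_strat (fin_seq one (take i (As @ [A])), C) F P r \<and> mem_fam ((As @ [A]) ! i) C P r"
  proof cases
    case 1
    then show ?thesis using assms(1) by (auto simp: legal_def nth_append)
  next
    case 2
    then show ?thesis using assms by auto
  qed
qed

lemma strategy_cover:
  assumes "mem_strat (s, C) F P r" "(r, p) \<in> P"
  shows "open_cover (check_points one X) (check_base one X) C P r"
proof -
  note imp = strategy[unfolded is_strategy_ONE_def, THEN fAndD1, THEN fAllD[where x = s],
      THEN fAllD[where x = C]]
  have *: "persistent P (is_position B s \<^bold>\<and> open_cover S B C)" for S :: "('a, 'p) pts" and B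
    unfolding is_position_def is_seq_def open_cover_def is_open_def by (intro persistent_intros)
  show ?thesis
    using fImpD[OF persistent_fMem * imp assms(2,1)] unfolding fAnd_iff by blast
qed

lemma legal_open:
  assumes "legal r As" "i < length As"
  shows "is_open (check_base one X) (As ! i) P r"
proof -
  have r: "(r, p) \<in> P" using assms(1) legal_def by blast
  obtain C where "mem_strat (fin_seq one (take i As), C) F P r" "mem_fam (As ! i) C P r"
    using assms legal_def by blast
  then show ?thesis using open_cover_is_open strategy_cover r P_field by blast
qed

text \<open>All pairs in \<open>fin_seq\<close> carry the largest condition and indices are
  urelements, so only the comparison with the entry is left to be forced.\<close>

lemma mem_fin_seq:
  assumes "r \<in> Field P"
  shows "mem_seq (m, A) (fin_seq one As) P r \<longleftrightarrow> m < length As \<and> eq_pts A (As ! m) P r"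
proof
  assume L: "mem_seq (m, A) (fin_seq one As) P r"
  have *: "\<exists>t. (t, q) \<in> P \<and> m < length As \<and> eq_pts A (As ! m) P t" if "(q, r) \<in> P" for q
    using mem_seqD[OF L that] by (auto simp: fin_seq_def)
  show "m < length As \<and> eq_pts A (As ! m) P r"
    using *[OF P_refl[OF assms]] persistent_dense[OF persistent_fSetEq assms] * by meson
next
  assume "m < length As \<and> eq_pts A (As ! m) P r"
  then show "mem_seq (m, A) (fin_seq one As) P r"
    by (intro mem_seq_elemI[of m "As ! m" one]) (auto simp: fin_seq_def P_one assms)
qed

lemma is_seq_fin_seq:
  assumes r: "r \<in> Field P"
  shows "is_seq {..<length As} (fin_seq one As) P r"
  unfolding is_seq_def
proof (intro fAndI fAllI; rule fImpI[OF r])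
  fix m A q assume "(q, r) \<in> P" "mem_seq (m, A) (fin_seq one As) P q"
  then show "fGround (m \<in> {..<length As}) P q"
    using P_field by (simp add: fGround_iff mem_fin_seq)
next
  fix m q assume q: "(q, r) \<in> P" "fGround (m \<in> {..<length As}) P q"
  have "mem_seq (m, As ! m) (fin_seq one As) P q"
    using q P_field(1)[OF q(1)] by (simp add: fGround_iff mem_fin_seq eq_pts_refl)
  then show "(\<^bold>\<exists>A. mem_seq (m, A) (fin_seq one As)) P q"
    by (rule fExI[OF persistent_fMem])
next
  fix m A A' q
  assume q: "(q, r) \<in> P" "(mem_seq (m, A) (fin_seq one As) \<^bold>\<and> mem_seq (m, A') (fin_seq one As)) P q"
  then show "eq_pts A A' P q"
    using P_field(1)[OF q(1)] eq_pts_trans eq_pts_sym by (metis fAnd_iff mem_fin_seq)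
qed

text \<open>Legal moves are open because they belong to open covers played by ONE. Hence a legal
  list is in the domain of the strategy and ONE has an answer to it.\<close>

lemma legal_position:
  assumes "legal r As"
  shows "is_position (check_base one X) (fin_seq one As) P r"
proof -
  have r: "r \<in> Field P" using assms legal_def P_field by blast
  have per: "persistent P (is_seq D s)" for D and s :: "('a, 'p) seq"
    unfolding is_seq_def by (intro persistent_intros)
  have "(\<^bold>\<exists>n. is_seq {..<n} (fin_seq one As)) P r"
    by (rule fExI[where \<phi> = "\<lambda>n. is_seq {..<n} (fin_seq one As)", OF per is_seq_fin_seq[OF r]])
  moreover have "(\<^bold>\<forall>m. \<^bold>\<forall>A. mem_seq (m, A) (fin_seq one As) \<^bold>\<longrightarrow> is_open (check_base one X) A) P r"
  proof (intro fAllI; rule fImpI[OF r])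
    fix m A q assume q: "(q, r) \<in> P" "mem_seq (m, A) (fin_seq one As) P q"
    have qF: "q \<in> Field P" using q P_field by blast
    with q have *: "m < length As" "eq_pts A (As ! m) P q" by (auto simp: mem_fin_seq)
    show "is_open (check_base one X) A P q"
      by (rule is_open_cong[OF qF eq_pts_sym[OF *(2)] legal_open[OF legal_mono[OF assms q(1)] *(1)]])
  qed
  ultimately show ?thesis unfolding is_position_def by (rule fAndI)
qed

lemma strategy_total:
  assumes "legal r As"
  shows "\<exists>q C. (q, r) \<in> P \<and> mem_strat (fin_seq one As, C) F P q"
proof -
  have r: "(r, p) \<in> P" using assms legal_def by blast
  note imp = strategy[unfolded is_strategy_ONE_def, THEN fAndD2, THEN fAndD1,
      THEN fAllD[where x = "fin_seq one As"]]
  have *: "persistent P (is_position B s)" for s :: "('a, 'p) seq" and B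
    unfolding is_position_def is_open_def by (intro persistent_intros)
  show ?thesis
    using fExD[OF fImpD[OF * persistent_fEx imp r legal_position[OF assms]] P_refl[OF P_field(1)[OF r]]]
    by blast
qed

text \<open>The answer of ONE is forced to be a cover, so some stronger condition finds a member
  \<open>A\<close> containing \<open>x\<close>; since \<open>A\<close> is forced to be open, a
  further strengthening puts a whole ground model neighbourhood of \<open>x\<close> into
  \<open>A\<close>.\<close>

lemma legal_extend:
  assumes "legal r As" "x \<in> topspace X"
  shows "\<exists>q A U. (q, r) \<in> P \<and> legal q (As @ [A]) \<and> openin X U \<and> x \<in> U \<and> (\<forall>y\<in>U. mem_pts y A P q)"
proof -
  obtain q C where q: "(q, r) \<in> P" and C: "mem_strat (fin_seq one As, C) F P q"
    using strategy_total[OF assms(1)] by blast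
  have qp: "(q, p) \<in> P" using legal_mono[OF assms(1) q] legal_def by blast
  have qF: "q \<in> Field P" using q P_field by blast
  note cover = strategy_cover[OF C qp]
  note imp = cover[unfolded open_cover_def, THEN fAndD2, THEN fAllD[where x = x]]
  have "mem_pts x (check_points one X) P q"
    using assms(2) by (simp add: check_points_def mem_pts_check[OF qF])
  from fExD[OF fImpD[OF persistent_fMem persistent_fEx imp P_refl[OF qF] this] P_refl[OF qF]]
  obtain t A where t: "(t, q) \<in> P" and A: "mem_fam A C P t" "mem_pts x A P t"
    unfolding fAnd_iff by blast
  have tF: "t \<in> Field P" using t P_field by blast
  have tp: "(t, p) \<in> P" by (rule P_trans[OF t qp])
  have Ct: "mem_strat (fin_seq one As, C) F P t" by (rule persistent_mono[OF persistent_fMem C t])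
  have "is_open (check_base one X) A P t"
    by (rule open_cover_is_open[OF tF strategy_cover[OF Ct tp] A(1)])
  then obtain u U where u: "(u, t) \<in> P" "openin X U" "x \<in> U" "\<forall>y\<in>U. mem_pts y A P u"
    using is_open_iff[OF tF] A(2) P_refl[OF tF] by meson
  have "legal t (As @ [A])"
    by (rule legal_snoc[OF legal_mono[OF assms(1) P_trans[OF t q]] Ct A(1)])
  then have "legal u (As @ [A])" using legal_mono u(1) by blast
  moreover have "(u, r) \<in> P" by (rule P_trans[OF u(1) P_trans[OF t q]])
  ultimately show ?thesis using u by blast
qed

text \<open>The sets \<open>U\<close> from \<open>legal_extend\<close>, for all conditions below
  \<open>r\<close>, form an open cover in the ground model, and almost Lindelof selects countably
  many of them. Legality is a premise inside the statement, so that some \<open>E\<close> can be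
  chosen for every \<open>r\<close> and \<open>As\<close>.\<close>

lemma legal_extend_countable:
  assumes "almost_Lindelof_space X"
  shows "\<exists>E. countable E \<and> (legal r As \<longrightarrow>
    (\<forall>(q, A) \<in> E. (q, r) \<in> P \<and> legal q (As @ [A])) \<and>
    (\<forall>x\<in>topspace X. \<exists>(q, A) \<in> E. \<exists>U. openin X U \<and> x \<in> X closure_of U \<and> (\<forall>y\<in>U. mem_pts y A P q)))"
proof (cases "legal r As")
  case True
  define ok where "ok U qA \<longleftrightarrow> (case qA of (q, A) \<Rightarrow> (q, r) \<in> P \<and> legal q (As @ [A]) \<and>
    openin X U \<and> (\<forall>y\<in>U. mem_pts y A P q))" for U qA
  let ?\<U> = "{U. \<exists>qA. ok U qA}"
  have op: "\<forall>U\<in>?\<U>. openin X U" by (auto simp: ok_def)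
  have "topspace X \<subseteq> \<Union>?\<U>"
  proof
    fix x assume "x \<in> topspace X"
    from legal_extend[OF True this] obtain q A U where "ok U (q, A)" "x \<in> U"
      unfolding ok_def by blast
    then show "x \<in> \<Union>?\<U>" by blast
  qed
  moreover have "\<Union>?\<U> \<subseteq> topspace X" using op openin_subset by blast
  ultimately have "\<Union>?\<U> = topspace X" by (rule subset_antisym[rotated])
  with op assms obtain \<V> where V: "\<V> \<subseteq> ?\<U>" "countable \<V>" "(\<Union>V\<in>\<V>. X closure_of V) = topspace X"
    unfolding almost_Lindelof_space_def by (elim allE[of _ ?\<U>]) blast
  \<comment> \<open>One witnessing pair for each selected open set; the image of the countable
    subfamily is the required \<open>E\<close>.\<close>
  define g where "g U = (SOME qA. ok U qA)" for U
  have g: "ok U (g U)" if "U \<in> \<V>" for U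
  proof -
    have "\<exists>qA. ok U qA" using that V(1) by blast
    then show ?thesis unfolding g_def by (rule someI_ex)
  qed
  have "\<exists>(q, A) \<in> g ` \<V>. \<exists>U. openin X U \<and> x \<in> X closure_of U \<and> (\<forall>y\<in>U. mem_pts y A P q)"
    if "x \<in> topspace X" for x
  proof -
    have "x \<in> (\<Union>V\<in>\<V>. X closure_of V)" using that V(3) by simp
    then obtain U where "U \<in> \<V>" "x \<in> X closure_of U" by (rule UN_E)
    moreover obtain q A where gU: "g U = (q, A)" by (cases "g U")
    moreover have "openin X U \<and> (\<forall>y\<in>U. mem_pts y A P q)"
      using g[OF \<open>U \<in> \<V>\<close>] by (simp add: ok_def gU)
    moreover have "(q, A) \<in> g ` \<V>" using gU \<open>U \<in> \<V>\<close> image_eqI by metis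
    ultimately show ?thesis by blast
  qed
  moreover have "\<forall>(q, A) \<in> g ` \<V>. (q, r) \<in> P \<and> legal q (As @ [A])"
    using g by (fastforce simp: ok_def)
  ultimately show ?thesis using V(2) by (intro exI[of _ "g ` \<V>"]) auto
qed auto

end

section \<open>Closing off under countably many values and counting finite maps\<close>

section \<open>Countability\<close>

text \<open>A Loewenheim-Skolem argument: close off \<omega> times. The stages increase, so a finite
  list from their union already lies in one stage, and its values lie in the next.\<close>

lemma countable_closure:
  fixes f :: "'z list \<Rightarrow> 'z set"
  assumes "\<And>xs. countable (f xs)"
  shows "\<exists>Z. countable Z \<and> (\<forall>xs. set xs \<subseteq> Z \<longrightarrow> f xs \<subseteq> Z)"
proof -
  define S where "S = rec_nat {} (\<lambda>_ Z. Z \<union> (\<Union>xs\<in>lists Z. f xs))"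
  have S0: "S 0 = {}" and SS: "S (Suc n) = S n \<union> (\<Union>xs\<in>lists (S n). f xs)" for n
    by (simp_all add: S_def)
  have "countable (S n)" for n
    by (induction n) (auto simp: S0 SS assms)
  moreover have mono: "S m \<subseteq> S n" if "m \<le> n" for m n
    using that by (rule lift_Suc_mono_le[rotated]) (auto simp: SS)
  have "f xs \<subseteq> (\<Union>n. S n)" if "set xs \<subseteq> (\<Union>n. S n)" for xs
  proof -
    have "\<exists>n. set xs \<subseteq> S n"
      using that
    proof (induction xs)
      case (Cons x xs)
      then obtain m n where "x \<in> S m" "set xs \<subseteq> S n" by auto
      then have "set (x # xs) \<subseteq> S (max m n)" using mono[of m "max m n"] mono[of n "max m n"] by auto
      then show ?case ..
    qed simp
    then obtain n where "set xs \<subseteq> S n" ..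
    then have "f xs \<subseteq> S (Suc n)" unfolding SS by (intro le_supI2 UN_upper) auto
    then show ?thesis by blast
  qed
  ultimately show ?thesis by (intro exI[of _ "\<Union>n. S n"]) auto
qed

text \<open>A finite map is determined by its graph, a finite subset of a countable product.\<close>

lemma countable_finite_maps:
  assumes "countable D"
  shows "countable {q :: 'a \<rightharpoonup> 'b::countable. finite (dom q) \<and> dom q \<subseteq> D}"
proof (rule countable_image_inj_on)
  have "countable (D \<times> (UNIV :: 'b set))" using assms by simp
  then have "countable {G. finite G \<and> G \<subseteq> D \<times> (UNIV :: 'b set)}"
    by (metis (no_types, lifting) Collect_cong conj_commute countable_Collect_finite_subset)
  then show "countable (Map.graph ` {q :: 'a \<rightharpoonup> 'b. finite (dom q) \<and> dom q \<subseteq> D})"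
    by (rule countable_subset[rotated])
      (auto simp: finite_graph_iff_finite_dom dest!: graph_domD)
  show "inj_on Map.graph {q :: 'a \<rightharpoonup> 'b. finite (dom q) \<and> dom q \<subseteq> D}"
    by (rule inj_onI, rule ext) (metis in_graphD in_graphI not_Some_eq)
qed

section \<open>Cohen conditions and moves read off a Cohen real\<close>

section \<open>Cohen forcing\<close>

lemma Field_cohen: "Field (cohen \<kappa>) = cohen_conditions \<kappa>"
  by (auto simp: Field_def cohen_def)

lemma cohen_iff: "(q, p) \<in> cohen \<kappa> \<longleftrightarrow> q \<in> cohen_conditions \<kappa> \<and> p \<in> cohen_conditions \<kappa> \<and> p \<subseteq>\<^sub>m q"
  by (auto simp: cohen_def)

lemma cohen_trans: "(r, q) \<in> cohen \<kappa> \<Longrightarrow> (q, p) \<in> cohen \<kappa> \<Longrightarrow> (r, p) \<in> cohen \<kappa>"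
  by (auto simp: cohen_iff intro: map_le_trans)

lemma cohen_extend: "(q, p) \<in> cohen \<kappa> \<Longrightarrow> q \<subseteq>\<^sub>m r \<Longrightarrow> r \<in> cohen_conditions \<kappa> \<Longrightarrow> (r, p) \<in> cohen \<kappa>"
  by (auto simp: cohen_iff intro: map_le_trans)

lemma cohen_one_field: "cohen_one \<in> Field (cohen \<kappa>)"
  by (simp add: Field_cohen cohen_one_def cohen_conditions_def)

lemma forcing_notion_cohen: "forcing_notion (cohen \<kappa>) cohen_one"
  by unfold_locales
    (use cohen_one_field[of \<kappa>] in \<open>auto simp: Field_cohen cohen_iff cohen_one_def intro: map_le_trans\<close>)

text \<open>Compatibility. The common extension \<open>t\<close> may be any partial function; when
  both maps are conditions, \<open>r ++ q\<close> is a common extension that is a condition.\<close>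

definition agree :: "('k \<rightharpoonup> 'v) \<Rightarrow> ('k \<rightharpoonup> 'v) \<Rightarrow> bool" where
  "agree r q \<longleftrightarrow> (\<exists>t. r \<subseteq>\<^sub>m t \<and> q \<subseteq>\<^sub>m t)"

lemma agree_add: "agree r q \<Longrightarrow> r \<subseteq>\<^sub>m r ++ q"
  by (force simp: agree_def map_le_def map_add_def split: option.splits)

text \<open>
  A condition reads the Cohen real at coordinate \<open>\<alpha>\<close> digit by digit. A digit \<open>d\<close> proposes the move
  \<open>e d = (r, A)\<close>; the move is made if it is admissible and \<open>r\<close> belongs to the generic filter, and
  otherwise the digit is skipped. The result is \<open>None\<close> if the condition does not decide the moves.
\<close>

primrec run ::
  "(nat \<Rightarrow> ('k \<times> nat \<rightharpoonup> nat) \<times> 'b) \<Rightarrow> ('b list \<Rightarrow> ('k \<times> nat \<rightharpoonup> nat) \<Rightarrow> bool) \<Rightarrow> 'k \<Rightarrow>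
    ('k \<times> nat \<rightharpoonup> nat) \<Rightarrow> nat \<Rightarrow> 'b list option" where
  "run e ok \<alpha> q 0 = Some []"
| "run e ok \<alpha> q (Suc m) = (case run e ok \<alpha> q m of None \<Rightarrow> None | Some As \<Rightarrow>
     (case q (\<alpha>, m) of None \<Rightarrow> None | Some d \<Rightarrow>
       (case e d of (r, A) \<Rightarrow>
         if \<not> ok (As @ [A]) r \<or> \<not> agree r q then Some As
         else if r \<subseteq>\<^sub>m q then Some (As @ [A]) else None)))"

text \<open>Each verdict on a digit is final: a proposal incompatible with \<open>q\<close> is
  incompatible with every extension of \<open>q\<close>, and a proposal included in \<open>q\<close>
  stays included.\<close>

lemma run_mono:
  assumes "q \<subseteq>\<^sub>m q'"
  shows "run e ok \<alpha> q m = Some As \<Longrightarrow> run e ok \<alpha> q' m = Some As"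
proof (induction m arbitrary: As)
  case (Suc m)
  then obtain Bs where Bs: "run e ok \<alpha> q m = Some Bs" by (auto split: option.splits)
  with Suc.prems obtain d where d: "q (\<alpha>, m) = Some d" by (auto split: option.splits)
  then have d': "q' (\<alpha>, m) = Some d" using assms by (metis domI map_le_def)
  obtain r A where e: "e d = (r, A)" by (cases "e d")
  have "agree r q" if "agree r q'"
    using that map_le_trans[OF assms] unfolding agree_def by blast
  moreover have "r \<subseteq>\<^sub>m q'" if "r \<subseteq>\<^sub>m q"
    using map_le_trans[OF that assms] .
  moreover have "agree r q'" if "r \<subseteq>\<^sub>m q"
    using map_le_trans[OF that assms] by (auto simp: agree_def intro!: exI[of _ q'])
  ultimately show ?case
    using Suc.prems Suc.IH[OF Bs] Bs d d' e by (auto split: if_splits)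
qed simp

lemma run_prefix:
  assumes "run e ok \<alpha> q (m + k) = Some As"
  shows "\<exists>Bs Cs. run e ok \<alpha> q m = Some Bs \<and> As = Bs @ Cs"
  using assms
proof (induction k arbitrary: As)
  case (Suc k)
  then obtain Bs where "run e ok \<alpha> q (m + k) = Some Bs" by (auto split: option.splits)
  moreover from this Suc.prems have "As = Bs \<or> (\<exists>A. As = Bs @ [A])"
    by (auto split: option.splits if_splits prod.splits)
  ultimately show ?case using Suc.IH by fastforce
qed simp

text \<open>Runs of one condition at different stages are prefixes of each other. This makes the
  generic play single-valued.\<close>

lemma run_unique:
  assumes "run e ok \<alpha> q m = Some As" "run e ok \<alpha> q n = Some Bs" "i < length As" "i < length Bs"
  shows "As ! i = Bs ! i"
proof -
  have *: "As ! i = Bs ! i" if "m \<le> n" "run e ok \<alpha> q m = Some As" "run e ok \<alpha> q n = Some Bs"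
      "i < length As" for m n As Bs
    using run_prefix[of e ok \<alpha> q m "n - m" Bs] that by (auto simp: nth_append)
  show ?thesis
  proof (cases "m \<le> n")
    case False
    then show ?thesis using *[of n m Bs As] assms by simp
  qed (use * assms in blast)
qed

text \<open>The last accepted proposal supplies \<open>r\<close>, and skipped digits keep it; before
  the first move \<open>p\<close> itself serves.\<close>

lemma run_ok:
  assumes "run e ok \<alpha> q m = Some As" "ok [] p" "p \<subseteq>\<^sub>m q"
  shows "\<exists>r. ok As r \<and> r \<subseteq>\<^sub>m q"
  using assms(1)
proof (induction m arbitrary: As)
  case (Suc m)
  then obtain Bs where "run e ok \<alpha> q m = Some Bs" by (auto split: option.splits)
  with Suc show ?case by (auto split: option.splits if_splits prod.splits)
qed (use assms in auto)

text \<open>The tree of partial plays in abstract form. Admissible conditions leave the coordinate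
  \<open>\<alpha>\<close> untouched, while \<open>ok_extend\<close> must cope with an arbitrary
  \<open>q\<close> below \<open>r\<close>, which may use \<open>\<alpha>\<close>; its
  \<open>r'\<close> therefore is only compatible with \<open>q\<close>, not below it.\<close>

locale branching =
  fixes \<kappa> :: "'k rel" and e :: "nat \<Rightarrow> ('k \<times> nat \<rightharpoonup> nat) \<times> 'b"
    and ok :: "'b list \<Rightarrow> ('k \<times> nat \<rightharpoonup> nat) \<Rightarrow> bool" and \<alpha> :: 'k and p
    and good :: "'c \<Rightarrow> ('k \<times> nat \<rightharpoonup> nat) \<Rightarrow> 'b \<Rightarrow> bool" and S :: "'c set"
  assumes \<alpha>: "\<alpha> \<in> Field \<kappa>"
    and ok_Nil: "ok [] p"
    and ok_cond: "ok As r \<Longrightarrow> r \<in> cohen_conditions \<kappa> \<and> (\<alpha>, i) \<notin> dom r"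
    and ok_extend: "ok As r \<Longrightarrow> (q, r) \<in> cohen \<kappa> \<Longrightarrow> x \<in> S \<Longrightarrow>
      \<exists>r' A. ok (As @ [A]) r' \<and> agree r' q \<and> good x r' A"
    and ok_enum: "ok (As @ [A]) r \<Longrightarrow> \<exists>d. e d = (r, A)"
begin

text \<open>The verdicts on the digits below \<open>M\<close> are decided one after another. The
  digits from \<open>M\<close> on stay free, since accepted conditions avoid
  \<open>\<alpha>\<close>.\<close>

lemma run_total:
  assumes "(q, p) \<in> cohen \<kappa>" "\<forall>i\<ge>M. (\<alpha>, i) \<notin> dom q" "m \<le> M"
  shows "\<exists>q' As. (q', q) \<in> cohen \<kappa> \<and> (\<forall>i\<ge>M. (\<alpha>, i) \<notin> dom q') \<and> run e ok \<alpha> q' m = Some As"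
  using assms(3)
proof (induction m)
  case 0
  then show ?case using assms by (auto simp: cohen_iff intro!: exI[of _ q])
next
  case (Suc m)
  then obtain q1 As where q1: "(q1, q) \<in> cohen \<kappa>" "\<forall>i\<ge>M. (\<alpha>, i) \<notin> dom q1"
    and run1: "run e ok \<alpha> q1 m = Some As" by auto
  \<comment> \<open>The value 0 for a missing digit is arbitrary.\<close>
  define q2 where "q2 = (if (\<alpha>, m) \<in> dom q1 then q1 else q1((\<alpha>, m) \<mapsto> 0))"
  have q12: "q1 \<subseteq>\<^sub>m q2" by (auto simp: q2_def map_le_def)
  have c2: "q2 \<in> cohen_conditions \<kappa>" using q1(1) \<alpha> by (auto simp: q2_def cohen_iff cohen_conditions_def)
  have M2: "\<forall>i\<ge>M. (\<alpha>, i) \<notin> dom q2" using q1(2) Suc.prems by (auto simp: q2_def)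
  have run2: "run e ok \<alpha> q2 m = Some As" using run_mono[OF q12 run1] .
  obtain d where d: "q2 (\<alpha>, m) = Some d" by (cases "(\<alpha>, m) \<in> dom q1") (auto simp: q2_def)
  obtain r A where e: "e d = (r, A)" by (cases "e d")
  show ?case
  proof (cases "ok (As @ [A]) r \<and> agree r q2")
    case False
    then have "run e ok \<alpha> q2 (Suc m) = Some As" using run2 d e by auto
    moreover have "(q2, q) \<in> cohen \<kappa>" by (rule cohen_extend[OF q1(1) q12 c2])
    ultimately show ?thesis using M2 by blast
  next
    case True
    \<comment> \<open>Including \<open>r\<close> turns a merely compatible proposal into an accepted
      move.\<close>
    define q3 where "q3 = r ++ q2"
    have r3: "r \<subseteq>\<^sub>m q3" using agree_add True by (auto simp: q3_def)
    have q23: "q2 \<subseteq>\<^sub>m q3" by (simp add: q3_def)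
    have "q3 \<in> cohen_conditions \<kappa>"
      using c2 ok_cond[of "As @ [A]" r] True by (auto simp: q3_def cohen_conditions_def)
    then have "(q3, q) \<in> cohen \<kappa>" by (rule cohen_extend[OF q1(1) map_le_trans[OF q12 q23]])
    moreover have "\<forall>i\<ge>M. (\<alpha>, i) \<notin> dom q3"
      using M2 ok_cond[of "As @ [A]" r] True by (auto simp: q3_def domIff)
    moreover have "q3 (\<alpha>, m) = Some d" using d by (simp add: q3_def)
    then have "run e ok \<alpha> q3 (Suc m) = Some (As @ [A])"
      using run_mono[OF q23 run2] e r3 True by (auto simp: agree_def)
    ultimately show ?thesis by blast
  qed
qed

text \<open>The genericity argument: once everything before a free digit is decided, that digit can
  be made to propose a move that is good for \<open>x\<close>. The bound \<open>n\<close> lets this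
  happen arbitrarily late.\<close>

lemma run_step:
  assumes "(q, p) \<in> cohen \<kappa>" "x \<in> S"
  shows "\<exists>q' M As A r. (q', q) \<in> cohen \<kappa> \<and> n \<le> M \<and> run e ok \<alpha> q' M = Some As \<and>
    run e ok \<alpha> q' (Suc M) = Some (As @ [A]) \<and> r \<subseteq>\<^sub>m q' \<and> r \<in> cohen_conditions \<kappa> \<and> good x r A"
proof -
  have "finite ((\<lambda>i. (\<alpha>, i)) -` dom q)"
    using assms(1) by (intro finite_vimageI) (auto simp: cohen_iff cohen_conditions_def inj_def)
  then obtain M0 where M0: "\<And>i. (\<alpha>, i) \<in> dom q \<Longrightarrow> i < M0"
    unfolding finite_nat_set_iff_bounded by auto
  \<comment> \<open>Beyond \<open>M0\<close> all digits of \<open>q\<close> at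
    \<open>\<alpha>\<close> are free.\<close>
  define M where "M = max M0 n"
  have "\<forall>i\<ge>M. (\<alpha>, i) \<notin> dom q" using M0 by (fastforce simp: M_def)
  from run_total[OF assms(1) this order_refl] obtain q1 As
    where q1: "(q1, q) \<in> cohen \<kappa>" "\<forall>i\<ge>M. (\<alpha>, i) \<notin> dom q1" and run1: "run e ok \<alpha> q1 M = Some As" by blast
  have p1: "p \<subseteq>\<^sub>m q1" using cohen_trans[OF q1(1) assms(1)] by (simp add: cohen_iff)
  \<comment> \<open>\<open>q1\<close> need not be admissible, so \<open>ok_extend\<close> is applied
    to an admissible condition \<open>r0\<close> that it extends.\<close>
  obtain r0 where r0: "ok As r0" "r0 \<subseteq>\<^sub>m q1" using run_ok[where ok = ok, OF run1 ok_Nil p1] by blast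
  then have "(q1, r0) \<in> cohen \<kappa>" using ok_cond q1(1) by (auto simp: cohen_iff)
  from ok_extend[OF r0(1) this assms(2)] obtain r A
    where r: "ok (As @ [A]) r" "agree r q1" "good x r A" by blast
  obtain d where d: "e d = (r, A)" using ok_enum[OF r(1)] by blast
  \<comment> \<open>Neither \<open>r\<close> nor \<open>q1\<close> decides digit \<open>M\<close> at
    \<open>\<alpha>\<close>, so it can be set to the code of \<open>(r, A)\<close>.\<close>
  define q2 where "q2 = (r ++ q1)((\<alpha>, M) \<mapsto> d)"
  have rc: "r \<in> cohen_conditions \<kappa>" "(\<alpha>, M) \<notin> dom r" using ok_cond[OF r(1)] by auto
  have 12: "q1 \<subseteq>\<^sub>m q2"
    using q1(2) by (auto simp: q2_def map_le_def)
  have r2: "r \<subseteq>\<^sub>m q2" using agree_add[OF r(2)] rc(2) by (auto simp: q2_def map_le_def)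
  have "q2 \<in> cohen_conditions \<kappa>"
    using rc q1(1) \<alpha> by (auto simp: q2_def cohen_iff cohen_conditions_def)
  then have "(q2, q) \<in> cohen \<kappa>" by (rule cohen_extend[OF q1(1) 12])
  moreover have "run e ok \<alpha> q2 M = Some As" by (rule run_mono[OF 12 run1])
  moreover from this have "run e ok \<alpha> q2 (Suc M) = Some (As @ [A])"
    using d r r2 by (auto simp: q2_def agree_def)
  ultimately show ?thesis using r2 rc r(3) by (intro exI conjI) (auto simp: M_def)
qed

lemma run_long:
  assumes "(q, p) \<in> cohen \<kappa>" "S \<noteq> {}"
  shows "\<exists>q' M As. (q', q) \<in> cohen \<kappa> \<and> run e ok \<alpha> q' M = Some As \<and> n \<le> length As"
proof (induction n)
  case 0
  then show ?case using assms by (intro exI[of _ q] exI[of _ 0]) (auto simp: cohen_iff)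
next
  case (Suc n)
  then obtain q1 M As where q1: "(q1, q) \<in> cohen \<kappa>" "run e ok \<alpha> q1 M = Some As" "n \<le> length As" by blast
  obtain x where x: "x \<in> S" using assms(2) by blast
  have "(q1, p) \<in> cohen \<kappa>" by (rule cohen_trans[OF q1(1) assms(1)])
  \<comment> \<open>Demanding a stage not before \<open>M\<close> keeps the moves found so far as a
    prefix, so the new move makes the list longer.\<close>
  from run_step[OF this x, of M] obtain q2 N Bs B where q2: "(q2, q1) \<in> cohen \<kappa>" "M \<le> N"
    "run e ok \<alpha> q2 N = Some Bs" "run e ok \<alpha> q2 (Suc N) = Some (Bs @ [B])" by blast
  have "run e ok \<alpha> q2 M = Some As" using run_mono[OF _ q1(2)] q2(1) by (auto simp: cohen_iff)
  then have "length As \<le> length Bs"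
    using run_prefix[of e ok \<alpha> q2 M "N - M" Bs] q2(2,3) by auto
  then have "Suc n \<le> length (Bs @ [B])" using q1(3) by simp
  moreover have "(q2, q) \<in> cohen \<kappa>" by (rule cohen_trans[OF q2(1) q1(1)])
  ultimately show ?case using q2(4) by blast
qed

end

section \<open>A name for the generic play and its victory for TWO\<close>

section \<open>The generic play\<close>

locale generic_play =
  strategy "cohen \<kappa>" cohen_one X F p +
  branching \<kappa> e ok \<alpha> p
    "\<lambda>x r A. \<exists>U. openin X U \<and> x \<in> X closure_of U \<and> (\<forall>y\<in>U. mem_pts y A (cohen \<kappa>) r)"
    "topspace X"
  for \<kappa> :: "'k rel" and X :: "'a topology" and F p e ok \<alpha> +
  assumes ok_legal: "ok As r \<Longrightarrow> legal r As"
    and nonempty: "topspace X \<noteq> {}"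
begin

abbreviation "P \<equiv> cohen \<kappa>"

text \<open>Each condition contributes the moves it decides, so the name denotes the union of the
  runs along the generic filter.\<close>

definition play :: "('a, 'k \<times> nat \<rightharpoonup> nat) seq" where
  "play = {((i, As ! i), q) |i As q. i < length As \<and> (\<exists>m. run e ok \<alpha> q m = Some As)}"

text \<open>The range of \<open>play\<close>, used as the witness for \<open>R\<close> in
  \<open>TWO_wins\<close>.\<close>

definition moves :: "('a, 'k \<times> nat \<rightharpoonup> nat) fam" where
  "moves = {(A, q). \<exists>i. ((i, A), q) \<in> play}"

lemma run_mono_cohen: "run e ok \<alpha> q m = Some As \<Longrightarrow> (r, q) \<in> P \<Longrightarrow> run e ok \<alpha> r m = Some As"
  by (rule run_mono) (auto simp: cohen_iff)

lemma run_legal: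
  assumes "run e ok \<alpha> q m = Some As" "(q, p) \<in> P"
  shows "legal q As"
proof -
  have "p \<subseteq>\<^sub>m q" using assms(2) by (simp add: cohen_iff)
  from run_ok[where ok = ok, OF assms(1) ok_Nil this]
  obtain r where r: "ok As r" "r \<subseteq>\<^sub>m q" by blast
  then have "(q, r) \<in> P" using ok_cond assms(2) by (auto simp: cohen_iff)
  then show ?thesis using legal_mono ok_legal r(1) by blast
qed

lemma playI:
  "run e ok \<alpha> q m = Some As \<Longrightarrow> i < length As \<Longrightarrow> ((i, As ! i), q) \<in> play"
  unfolding play_def by blast

lemma playE:
  assumes "((i, A), q) \<in> play"
  obtains m As where "run e ok \<alpha> q m = Some As" "i < length As" "A = As ! i"
  using assms unfolding play_def by blast

lemma mem_playI:
  assumes "q \<in> Field P" "run e ok \<alpha> q m = Some As" "i < length As" "eq_pts A (As ! i) P q"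
  shows "mem_seq (i, A) play P q"
  by (rule mem_seq_elemI[OF playI[OF assms(2,3)] P_refl[OF assms(1)] assms(4)])

lemma mem_playD:
  assumes "mem_seq (i, A) play P q" "(q', q) \<in> P"
  shows "\<exists>r m As. (r, q') \<in> P \<and> run e ok \<alpha> r m = Some As \<and> i < length As \<and> eq_pts A (As ! i) P r"
proof -
  obtain r B t where r: "(r, q') \<in> P" "((i, B), t) \<in> play" "(r, t) \<in> P" "eq_pts A B P r"
    using mem_seqD[OF assms] by blast
  obtain m As where "run e ok \<alpha> t m = Some As" "i < length As" "B = As ! i"
    using r(2) by (rule playE)
  then show ?thesis using r run_mono_cohen by blast
qed

text \<open>Totality is the density statement \<open>run_long\<close>. Two values at one index are
  compared below a condition that decides both runs, where \<open>run_unique\<close>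
  applies.\<close>

lemma is_seq_play: "is_seq UNIV play P p"
  unfolding is_seq_def
proof (intro fAndI fAllI; rule fImpI[OF p_field])
  show "fGround (m \<in> UNIV) P q" for m q by (simp add: fGround_iff)
next
  fix m q assume q: "(q, p) \<in> P"
  show "(\<^bold>\<exists>A. mem_seq (m, A) play) P q"
  proof (rule fEx_dense)
    fix q' assume q': "(q', q) \<in> P"
    obtain r M As where r: "(r, q') \<in> P" "run e ok \<alpha> r M = Some As" "Suc m \<le> length As"
      using run_long[OF P_trans[OF q' q] nonempty] by blast
    have rF: "r \<in> Field P" using r(1) P_field by blast
    have "mem_seq (m, As ! m) play P r"
      using mem_playI[OF rF r(2) _ eq_pts_refl[OF rF]] r(3) by simp
    then show "\<exists>r A. (r, q') \<in> P \<and> mem_seq (m, A) play P r" using r(1) by blast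
  qed
next
  fix m A A' q
  assume q: "(q, p) \<in> P" and "(mem_seq (m, A) play \<^bold>\<and> mem_seq (m, A') play) P q"
  then have A: "mem_seq (m, A) play P q" and A': "mem_seq (m, A') play P q"
    by (blast dest: fAndD1 fAndD2)+
  show "eq_pts A A' P q"
  proof (rule persistent_dense[OF persistent_fSetEq])
    show "q \<in> Field P" using q P_field by blast
    fix q' assume q': "(q', q) \<in> P"
    obtain r M As where r: "(r, q') \<in> P" "run e ok \<alpha> r M = Some As" "m < length As"
        "eq_pts A (As ! m) P r"
      using mem_playD[OF A q'] by blast
    obtain t N Bs where t: "(t, r) \<in> P" "run e ok \<alpha> t N = Some Bs" "m < length Bs"
        "eq_pts A' (Bs ! m) P t"
      using mem_playD[OF A' P_trans[OF r(1) q']] by blast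
    have tF: "t \<in> Field P" using t(1) P_field by blast
    have "As ! m = Bs ! m" by (rule run_unique[OF run_mono_cohen[OF r(2) t(1)] t(2) r(3) t(3)])
    then have "eq_pts A (Bs ! m) P t"
      using persistent_mono[OF persistent_fSetEq r(4) t(1)] by simp
    then have "eq_pts A A' P t" using eq_pts_trans[OF tF] eq_pts_sym[OF t(4)] by blast
    then show "\<exists>t. (t, q') \<in> P \<and> eq_pts A A' P t" using P_trans[OF t(1) r(1)] by blast
  qed
qed

text \<open>A condition that has decided \<open>n\<close> moves knows the restriction: entries
  contributed by other conditions agree with its own run by \<open>run_unique\<close>.\<close>

lemma is_restriction_play:
  assumes r: "r \<in> Field P" and run: "run e ok \<alpha> r M = Some As" and n: "n \<le> length As"
  shows "is_restriction play n (fin_seq cohen_one (take n As)) P r"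
  unfolding is_restriction_def
proof (intro fAllI; rule fIffI[OF r])
  fix m A q assume q: "(q, r) \<in> P"
  have qF: "q \<in> Field P" using q P_field by blast
  have runq: "run e ok \<alpha> q M = Some As" by (rule run_mono_cohen[OF run q])
  have "eq_pts A (As ! m) P q" if m: "m < n" and mem: "mem_seq (m, A) play P q"
  proof (rule persistent_dense[OF persistent_fSetEq qF])
    fix q' assume q': "(q', q) \<in> P"
    obtain t N Bs where t: "(t, q') \<in> P" "run e ok \<alpha> t N = Some Bs" "m < length Bs"
        "eq_pts A (Bs ! m) P t"
      using mem_playD[OF mem q'] by blast
    have "As ! m = Bs ! m"
      using run_unique[OF run_mono_cohen[OF runq P_trans[OF t(1) q']] t(2)] m n t(3) by simp
    then show "\<exists>t. (t, q') \<in> P \<and> eq_pts A (As ! m) P t" using t(1,4) by auto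
  qed
  moreover have "mem_seq (m, A) play P q" if "m < n" "eq_pts A (As ! m) P q"
    using mem_playI[OF qF runq _ that(2)] that(1) n by simp
  ultimately show "mem_seq (m, A) (fin_seq cohen_one (take n As)) P q \<longleftrightarrow>
      (mem_seq (m, A) play \<^bold>\<and> fGround (m < n)) P q"
    using n by (auto simp: mem_fin_seq[OF qF] fAnd_iff fGround_iff)
qed

lemma is_play_play: "is_play F play P p"
  unfolding is_play_def
proof (rule fAndI, rule is_seq_play, rule fAllI, rule fEx_dense)
  fix n q assume q: "(q, p) \<in> P"
  obtain r M As where r: "(r, q) \<in> P" "run e ok \<alpha> r M = Some As" "Suc n \<le> length As"
    using run_long[OF q nonempty] by blast
  have rF: "r \<in> Field P" using r(1) P_field by blast
  have "legal r As" by (rule run_legal[OF r(2) P_trans[OF r(1) q]])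
  then obtain C where C: "mem_strat (fin_seq cohen_one (take n As), C) F P r" "mem_fam (As ! n) C P r"
    using r(3) unfolding legal_def by (metis Suc_le_lessD)
  let ?s = "fin_seq cohen_one (take n As)"
  \<comment> \<open>Abstracting the matrix lets the inner quantifiers be introduced one at a time;
    the quantifier over \<open>s\<close> is met by density.\<close>
  define \<Phi> where "\<Phi> = (\<lambda>s C A. is_restriction play n s \<^bold>\<and> mem_strat (s, C) F \<^bold>\<and>
      mem_seq (n, A) play \<^bold>\<and> mem_fam A C)"
  have "mem_seq (n, As ! n) play P r"
    using mem_playI[OF rF r(2) _ eq_pts_refl[OF rF]] r(3) by simp
  then have all: "\<Phi> ?s C (As ! n) P r"
    unfolding \<Phi>_def using C is_restriction_play[OF rF r(2)] r(3) by (intro fAndI) auto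
  have per: "persistent P (\<Phi> ?s C (As ! n))"
    unfolding \<Phi>_def is_restriction_def by (intro persistent_intros)
  have "fEx (\<Phi> ?s C) P r"
    by (rule fExI[where \<phi> = "\<Phi> ?s C" and x = "As ! n", OF per all])
  then have "fEx (\<lambda>C. fEx (\<Phi> ?s C)) P r"
    by (rule fExI[where \<phi> = "\<lambda>C. fEx (\<Phi> ?s C)" and x = C, OF persistent_fEx])
  with r(1) have "\<exists>r s. (r, q) \<in> P \<and> fEx (\<lambda>C. fEx (\<Phi> s C)) P r" by blast
  then show "\<exists>r s. (r, q) \<in> P \<and> (\<^bold>\<exists>C. \<^bold>\<exists>A. is_restriction play n s \<^bold>\<and> mem_strat (s, C) F \<^bold>\<and>
      mem_seq (n, A) play \<^bold>\<and> mem_fam A C) P r"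
    unfolding \<Phi>_def .
qed

lemma mem_moves_iff:
  assumes q: "q \<in> Field P"
  shows "mem_fam A moves P q \<longleftrightarrow> (\<^bold>\<exists>n. mem_seq (n, A) play) P q"
proof
  assume L: "mem_fam A moves P q"
  show "(\<^bold>\<exists>n. mem_seq (n, A) play) P q"
  proof (rule fEx_dense)
    fix q' assume "(q', q) \<in> P"
    from fMemD[OF L this] obtain r B t where r: "(r, q') \<in> P" "(B, t) \<in> moves" "(r, t) \<in> P"
      "eq_pts A B P r" by blast
    then obtain n where "((n, B), t) \<in> play" unfolding moves_def by blast
    then show "\<exists>r n. (r, q') \<in> P \<and> mem_seq (n, A) play P r" using r mem_seq_elemI by blast
  qed
next
  assume R: "(\<^bold>\<exists>n. mem_seq (n, A) play) P q"
  show "mem_fam A moves P q"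
  proof (rule fMemI)
    fix q' assume "(q', q) \<in> P"
    from fExD[OF R this] obtain r n where r: "(r, q') \<in> P" "mem_seq (n, A) play P r" by blast
    from mem_seqD[OF r(2) P_refl[OF P_field(1)[OF r(1)]]] obtain t B s where
      t: "(t, r) \<in> P" "((n, B), s) \<in> play" "(t, s) \<in> P" "eq_pts A B P t" by blast
    then have "(B, s) \<in> moves" unfolding moves_def by blast
    then show "\<exists>r b s. (r, q') \<in> P \<and> (b, s) \<in> moves \<and> (r, s) \<in> P \<and> eq_pts A b P r"
      using t P_trans[OF t(1) r(1)] by blast
  qed
qed

lemma moves_open:
  assumes "(q, p) \<in> P" "mem_fam A moves P q"
  shows "is_open (check_base cohen_one X) A P q"
proof (rule persistent_dense[OF persistent_is_open P_field(1)[OF assms(1)]])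
  fix q' assume q': "(q', q) \<in> P"
  from fMemD[OF assms(2) this] obtain r B t where r: "(r, q') \<in> P" "(B, t) \<in> moves" "(r, t) \<in> P"
      "eq_pts A B P r" by blast
  then obtain n where "((n, B), t) \<in> play" unfolding moves_def by blast
  then obtain m As where t: "run e ok \<alpha> t m = Some As" "n < length As" "B = As ! n" by (rule playE)
  have rp: "(r, p) \<in> P" using P_trans[OF r(1) P_trans[OF q' assms(1)]] .
  have "legal r As" by (rule run_legal[OF run_mono_cohen[OF t(1) r(3)] rp])
  then have "is_open (check_base cohen_one X) B P r" using legal_open t(2,3) by blast
  then have "is_open (check_base cohen_one X) A P r"
    using is_open_cong[OF P_field(1)[OF rp] eq_pts_sym[OF r(4)]] by blast
  then show "\<exists>r. (r, q') \<in> P \<and> is_open (check_base cohen_one X) A P r" using r(1) by blast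
qed

text \<open>An open neighbourhood of \<open>x\<close> in the extension includes, densely, a ground
  model neighbourhood of \<open>x\<close>, which meets \<open>U\<close> already in the ground model;
  the common point lies in \<open>A\<close>.\<close>

lemma in_closureI:
  assumes q: "q \<in> Field P" and U: "openin X U" "x \<in> X closure_of U" "\<forall>y\<in>U. mem_pts y A P q"
  shows "in_closure (check_points cohen_one X) (check_base cohen_one X) x A P q"
  unfolding in_closure_def
proof (rule fAndI, goal_cases)
  case 1
  have "x \<in> topspace X" using U(2) by (simp add: in_closure_of)
  then show ?case by (simp add: check_points_def mem_pts_check[OF q])
next
  case 2
  show ?case
  proof (rule fAllI, rule fImpI[OF q], rule fEx_dense)
    fix V t t'
    assume t: "(t, q) \<in> P" and V: "(is_open (check_base cohen_one X) V \<^bold>\<and> mem_pts x V) P t"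
      and t': "(t', t) \<in> P"
    have "is_open (check_base cohen_one X) V P t" by (rule fAndD1[OF V])
    moreover have "mem_pts x V P t'" by (rule persistent_mono[OF persistent_fMem fAndD2[OF V] t'])
    ultimately obtain w W where w: "(w, t') \<in> P" "openin X W" "x \<in> W" "\<forall>y\<in>W. mem_pts y V P w"
      unfolding is_open_iff[OF P_field(1)[OF t]] using t' by meson
    obtain y where y: "y \<in> U" "y \<in> W" using U(2) w(2,3) unfolding in_closure_of by blast
    have "(w, q) \<in> P" by (rule P_trans[OF w(1) P_trans[OF t' t]])
    then have "mem_pts y A P w" using persistent_mono[OF persistent_fMem] U(3) y(1) by metis
    then have "(mem_pts y V \<^bold>\<and> mem_pts y A) P w" using w(4) y(2) by (intro fAndI) auto
    with w(1) show "\<exists>r y. (r, t') \<in> P \<and> (mem_pts y V \<^bold>\<and> mem_pts y A) P r" by blast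
  qed
qed

text \<open>Below any condition \<open>run_step\<close> finds one deciding a move that is good for
  the given point, and \<open>in_closureI\<close> carries the closure over to the extension.\<close>

lemma TWO_wins_play: "TWO_wins (check_points cohen_one X) (check_base cohen_one X) play P p"
  unfolding TWO_wins_def
proof (rule fExI)
  let ?S = "check_points cohen_one X" and ?B = "check_base cohen_one X"
  show "persistent P ((\<^bold>\<forall>A. mem_fam A moves \<^bold>\<longleftrightarrow> (\<^bold>\<exists>n. mem_seq (n, A) play)) \<^bold>\<and>
      closure_cover ?S ?B moves)"
    unfolding closure_cover_def is_open_def by (intro persistent_intros)
  have "closure_cover ?S ?B moves P p"
    unfolding closure_cover_def
  proof (intro fAndI fAllI; rule fImpI[OF p_field])
    show "is_open ?B U P q" if "(q, p) \<in> P" "mem_fam U moves P q" for U q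
      using that by (rule moves_open)
  next
    fix x q assume q: "(q, p) \<in> P" and "mem_pts x ?S P q"
    then have x: "x \<in> topspace X" by (simp add: check_points_def mem_pts_check[OF P_field(1)[OF q]])
    show "(\<^bold>\<exists>U. mem_fam U moves \<^bold>\<and> in_closure ?S ?B x U) P q"
    proof (rule fEx_dense)
      fix q' assume q': "(q', q) \<in> P"
      from run_step[OF P_trans[OF q' q] x] obtain r M As A t U where r: "(r, q') \<in> P"
        "run e ok \<alpha> r (Suc M) = Some (As @ [A])" "t \<subseteq>\<^sub>m r" "t \<in> cohen_conditions \<kappa>"
        and U: "openin X U" "x \<in> X closure_of U" "\<forall>y\<in>U. mem_pts y A P t" by blast
      have rF: "r \<in> Field P" using r(1) P_field by blast
      have rt: "(r, t) \<in> P" using r rF by (simp add: cohen_iff)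
      have "((length As, A), r) \<in> play" using playI[OF r(2), of "length As"] by simp
      then have "(A, r) \<in> moves" unfolding moves_def by blast
      then have "mem_fam A moves P r"
        by (rule fMem_elemI[OF _ P_refl[OF rF] persistent_fSetEq eq_pts_refl[OF rF]])
      moreover have "\<forall>y\<in>U. mem_pts y A P r" using U(3) persistent_mono[OF persistent_fMem _ rt] by metis
      then have "in_closure ?S ?B x A P r" by (rule in_closureI[OF rF U(1,2)])
      ultimately have "(mem_fam A moves \<^bold>\<and> in_closure ?S ?B x A) P r"
        unfolding fAnd_iff by blast
      with r(1) show "\<exists>r U. (r, q') \<in> P \<and> (mem_fam U moves \<^bold>\<and> in_closure ?S ?B x U) P r" by blast
    qed
  qed
  then show "((\<^bold>\<forall>A. mem_fam A moves \<^bold>\<longleftrightarrow> (\<^bold>\<exists>n. mem_seq (n, A) play)) \<^bold>\<and>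
      closure_cover ?S ?B moves) P p"
    by (intro fAndI fAllI fIffI[OF p_field] mem_moves_iff) (blast intro: P_field)
qed

end

section \<open>A countable tree of plays and a coordinate outside its support\<close>

section \<open>Closing off\<close>

locale cohen_strategy = strategy "cohen \<kappa>" cohen_one X F p
  for \<kappa> :: "'k rel" and X :: "'a topology" and F p +
  assumes almost_Lindelof: "almost_Lindelof_space X"
begin

text \<open>\<open>K\<close> and \<open>N\<close> play the part of the traces of a countable
  elementary submodel on \<kappa> and on the partial plays. The same countable tree serves all
  points \<open>x\<close>, since the sets from \<open>legal_extend_countable\<close> do not depend
  on \<open>x\<close>.\<close>

lemma countable_submodel:
  obtains K N where "countable K" "countable N" "[] \<in> N" "fst ` dom p \<subseteq> K"
    "\<And>q As x. legal q As \<Longrightarrow> fst ` dom q \<subseteq> K \<Longrightarrow> As \<in> N \<Longrightarrow> x \<in> topspace X \<Longrightarrow>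
      \<exists>r A. (r, q) \<in> cohen \<kappa> \<and> fst ` dom r \<subseteq> K \<and> As @ [A] \<in> N \<and> legal r (As @ [A]) \<and>
        (\<exists>U. openin X U \<and> x \<in> X closure_of U \<and> (\<forall>y\<in>U. mem_pts y A (cohen \<kappa>) r))"
proof -
  obtain E where E_countable: "\<And>q As. countable (E q As)"
    and E_legal: "\<And>q As r A. legal q As \<Longrightarrow> (r, A) \<in> E q As \<Longrightarrow> (r, q) \<in> cohen \<kappa> \<and> legal r (As @ [A])"
    and E_cover: "\<And>q As x. legal q As \<Longrightarrow> x \<in> topspace X \<Longrightarrow> \<exists>(r, A) \<in> E q As.
      \<exists>U. openin X U \<and> x \<in> X closure_of U \<and> (\<forall>y\<in>U. mem_pts y A (cohen \<kappa>) r)"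
  proof -
    define E where "E q As = (SOME E. countable E \<and> (legal q As \<longrightarrow>
      (\<forall>(r, A) \<in> E. (r, q) \<in> cohen \<kappa> \<and> legal r (As @ [A])) \<and>
      (\<forall>x\<in>topspace X. \<exists>(r, A) \<in> E. \<exists>U. openin X U \<and> x \<in> X closure_of U \<and>
        (\<forall>y\<in>U. mem_pts y A (cohen \<kappa>) r))))" for q As
    note E = someI_ex[OF legal_extend_countable[OF almost_Lindelof], folded E_def]
    show thesis
    proof (rule that[of E])
      show "countable (E q As)" for q As using E[of q As] by blast
      show "(r, q) \<in> cohen \<kappa> \<and> legal r (As @ [A])" if "legal q As" "(r, A) \<in> E q As" for q As r A
        using E[of q As] that by blast
      show "\<exists>(r, A) \<in> E q As. \<exists>U. openin X U \<and> x \<in> X closure_of U \<and> (\<forall>y\<in>U. mem_pts y A (cohen \<kappa>) r)"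
        if "legal q As" "x \<in> topspace X" for q As x
        using E[of q As] that by blast
    qed
  qed
  \<comment> \<open>\<open>Inl\<close> marks coordinates and \<open>Inr\<close> marks partial plays,
    so both are closed off together. A list mentions finitely many coordinates, and these support
    only countably many conditions.\<close>
  define conds where "conds xs = {q :: 'k \<times> nat \<rightharpoonup> nat. finite (dom q) \<and>
    dom q \<subseteq> {k. Inl k \<in> set xs} \<times> UNIV}" for xs :: "('k + ('a, 'k \<times> nat \<rightharpoonup> nat) pts list) list"
  define f where "f xs = insert (Inr []) (Inl ` fst ` dom p) \<union>
    (\<Union>q\<in>conds xs. \<Union>As\<in>{As. Inr As \<in> set xs}. if legal q As then
      \<Union>(r, A)\<in>E q As. insert (Inr (As @ [A])) (Inl ` fst ` dom r) else {})" for xs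
  have fin: "finite (dom q)" if "(q, r) \<in> cohen \<kappa>" for q r
    using that by (simp add: cohen_iff cohen_conditions_def)
  have "countable (f xs)" for xs
  proof -
    have "countable {k. Inl k \<in> set xs}"
      using countable_finite[OF finite_vimageI[of "set xs" Inl]] by (simp add: vimage_def)
    then have 1: "countable (conds xs)" unfolding conds_def by (intro countable_finite_maps) simp
    have 2: "countable {As. Inr As \<in> set xs}"
      using countable_finite[OF finite_vimageI[of "set xs" Inr]] by (simp add: vimage_def)
    have "countable (\<Union>(r, A)\<in>E q As. insert (Inr (As @ [A])) (Inl ` fst ` dom r))"
      if "legal q As" for q As
      using E_legal[OF that] by (intro countable_UN E_countable) (auto intro!: countable_finite fin)
    then have "countable (\<Union>q\<in>conds xs. \<Union>As\<in>{As. Inr As \<in> set xs}. if legal q As then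
      \<Union>(r, A)\<in>E q As. insert (Inr (As @ [A])) (Inl ` fst ` dom r) else {})"
      using 1 2 by (intro countable_UN) auto
    moreover have "finite (dom p)" using fin P_refl[OF p_field] by blast
    then have "countable (insert (Inr []) (Inl ` fst ` dom p))"
      by (intro countable_finite) simp
    ultimately show ?thesis unfolding f_def by (intro countable_Un)
  qed
  from countable_closure[of f, OF this] obtain Z
    where Z: "countable Z" and closed: "\<And>xs. set xs \<subseteq> Z \<Longrightarrow> f xs \<subseteq> Z" by blast
  define K where "K = {k. Inl k \<in> Z}"
  define N where "N = {As. Inr As \<in> Z}"
  have "Inl ` K \<subseteq> Z" by (auto simp: K_def)
  from countable_subset[OF this Z] have "countable K"
    by (rule countable_image_inj_on) simp
  moreover have "Inr ` N \<subseteq> Z" by (auto simp: N_def)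
  from countable_subset[OF this Z] have "countable N"
    by (rule countable_image_inj_on) simp
  moreover have "[] \<in> N" "fst ` dom p \<subseteq> K"
    using closed[of "[]"] unfolding f_def K_def N_def by auto
  moreover have "\<exists>r A. (r, q) \<in> cohen \<kappa> \<and> fst ` dom r \<subseteq> K \<and> As @ [A] \<in> N \<and> legal r (As @ [A]) \<and>
        (\<exists>U. openin X U \<and> x \<in> X closure_of U \<and> (\<forall>y\<in>U. mem_pts y A (cohen \<kappa>) r))"
    if q: "legal q As" "fst ` dom q \<subseteq> K" "As \<in> N" and x: "x \<in> topspace X" for q As x
  proof -
    have finq: "finite (dom q)" using q(1) fin unfolding legal_def by blast
    \<comment> \<open>This list codes the support of \<open>q\<close> together with
      \<open>As\<close>, so closure under \<open>f\<close> covers exactly this pair.\<close>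
    then obtain xs :: "('k + ('a, 'k \<times> nat \<rightharpoonup> nat) pts list) list"
      where xs: "set xs = insert (Inr As) (Inl ` fst ` dom q)"
      using finite_list[of "insert (Inr As) (Inl ` fst ` dom q)"] by auto
    have "q \<in> conds xs" using finq unfolding conds_def xs by force
    moreover have "As \<in> {As. Inr As \<in> set xs}" by (simp add: xs)
    ultimately have "(\<Union>(r, A)\<in>E q As. insert (Inr (As @ [A])) (Inl ` fst ` dom r)) \<subseteq> f xs"
      using q(1) unfolding f_def
      by (intro subsetI UnI2) (rule UN_I, assumption, rule UN_I, assumption, simp only: if_True)
    also have "set xs \<subseteq> Z" using q(2,3) unfolding xs K_def N_def by auto
    then have "f xs \<subseteq> Z" by (rule closed)
    finally have sub: "(\<Union>(r, A)\<in>E q As. insert (Inr (As @ [A])) (Inl ` fst ` dom r)) \<subseteq> Z" .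
    obtain r A where rA: "(r, A) \<in> E q As"
      "\<exists>U. openin X U \<and> x \<in> X closure_of U \<and> (\<forall>y\<in>U. mem_pts y A (cohen \<kappa>) r)"
      using E_cover[OF q(1) x] by blast
    have "insert (Inr (As @ [A])) (Inl ` fst ` dom r) \<subseteq> Z" using sub rA(1) by blast
    then have "As @ [A] \<in> N" "fst ` dom r \<subseteq> K" unfolding N_def K_def by auto
    then show ?thesis using E_legal[OF q(1) rA(1)] rA(2) by blast
  qed
  ultimately show thesis by (rule that)
qed

theorem ex_winning_play:
  assumes "topspace X \<noteq> {}" and "uncountable (Field \<kappa>)"
  shows "\<exists>T. is_play F T (cohen \<kappa>) p \<and>
    TWO_wins (check_points cohen_one X) (check_base cohen_one X) T (cohen \<kappa>) p"
proof -
  obtain K N where countable: "countable K" "countable N" and start: "[] \<in> N" "fst ` dom p \<subseteq> K"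
    and closed: "\<And>q As x. legal q As \<Longrightarrow> fst ` dom q \<subseteq> K \<Longrightarrow> As \<in> N \<Longrightarrow> x \<in> topspace X \<Longrightarrow>
      \<exists>r A. (r, q) \<in> cohen \<kappa> \<and> fst ` dom r \<subseteq> K \<and> As @ [A] \<in> N \<and> legal r (As @ [A]) \<and>
        (\<exists>U. openin X U \<and> x \<in> X closure_of U \<and> (\<forall>y\<in>U. mem_pts y A (cohen \<kappa>) r))"
    by (rule countable_submodel, rule that)
  have "\<not> Field \<kappa> \<subseteq> K" using assms(2) countable_subset[OF _ countable(1)] by metis
  \<comment> \<open>The digits at \<open>\<alpha>\<close> are not constrained by any condition
    supported in \<open>K\<close>.\<close>
  then obtain \<alpha> where \<alpha>: "\<alpha> \<in> Field \<kappa>" "\<alpha> \<notin> K" by (auto simp only: subset_iff)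
  define ok where "ok As r \<longleftrightarrow> legal r As \<and> fst ` dom r \<subseteq> K \<and> As \<in> N" for As r
  \<comment> \<open>All proposals a digit may have to code. Surplus pairs, such as one from
    \<open>last\<close> of the empty list, are harmless because \<open>ok\<close> is tested before a
    move is made.\<close>
  define M where "M = {r :: 'k \<times> nat \<rightharpoonup> nat. finite (dom r) \<and> dom r \<subseteq> K \<times> UNIV} \<times> last ` N"
  define e where "e = from_nat_into M"
  have cond: "r \<in> cohen_conditions \<kappa>" if "legal r As" for r As
    using that by (simp add: legal_def cohen_iff)
  have M: "countable M"
    unfolding M_def using countable by (intro countable_SIGMA countable_finite_maps) auto
  have enum: "\<exists>d. e d = (r, A)" if "ok (As @ [A]) r" for As A r
  proof -
    have "A \<in> last ` N" using that by (force simp: ok_def image_iff intro: bexI[of _ "As @ [A]"])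
    moreover have "finite (dom r) \<and> dom r \<subseteq> K \<times> UNIV"
      using that cond by (fastforce simp: ok_def cohen_conditions_def)
    ultimately have "(r, A) \<in> M" by (simp add: M_def)
    then show ?thesis unfolding e_def by (rule from_nat_into_surj[OF M])
  qed
  interpret generic_play \<kappa> X F p e ok \<alpha>
  proof
    show "\<alpha> \<in> Field \<kappa>" by fact
    show "ok [] p" using legal_Nil start by (simp add: ok_def)
    show "r \<in> cohen_conditions \<kappa> \<and> (\<alpha>, i) \<notin> dom r" if "ok As r" for As r i
      using that cond \<alpha>(2) by (force simp: ok_def)
    show "\<exists>d. e d = (r, A)" if "ok (As @ [A]) r" for As A r using that by (rule enum)
    show "legal r As" if "ok As r" for As r using that by (simp add: ok_def)
    show "topspace X \<noteq> {}" by fact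
    fix As r q x
    assume ok: "ok As r" and q: "(q, r) \<in> cohen \<kappa>" and x: "x \<in> topspace X"
    \<comment> \<open>The closure property speaks only of conditions supported in \<open>K\<close>.
      As \<open>r\<close> is supported there, the restriction is still below
      \<open>r\<close>.\<close>
    define q' where "q' = q |` (K \<times> UNIV)"
    have "r \<subseteq>\<^sub>m q'"
      using q ok by (force simp: q'_def ok_def cohen_iff map_le_def restrict_map_def)
    moreover have "q' \<in> cohen_conditions \<kappa>"
      using q by (auto simp: q'_def cohen_iff cohen_conditions_def)
    ultimately have "(q', r) \<in> cohen \<kappa>" using q by (simp add: cohen_iff)
    then have legal: "legal q' As" using ok by (blast intro: legal_mono[of r As q'] dest: ok_def[THEN iffD1])
    have "fst ` dom q' \<subseteq> K" by (auto simp: q'_def)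
    moreover have "As \<in> N" using ok by (simp add: ok_def)
    ultimately obtain r' A where r': "(r', q') \<in> cohen \<kappa>" "fst ` dom r' \<subseteq> K" "As @ [A] \<in> N"
      "legal r' (As @ [A])"
      and good: "\<exists>U. openin X U \<and> x \<in> X closure_of U \<and> (\<forall>y\<in>U. mem_pts y A (cohen \<kappa>) r')"
      using closed[OF legal _ _ x] by metis
    have ok': "ok (As @ [A]) r'" using r' by (simp add: ok_def)
    \<comment> \<open>On \<open>K\<close> the maps \<open>q\<close> and \<open>q'\<close> coincide,
      and \<open>r'\<close> extends \<open>q'\<close> with support in \<open>K\<close>; hence
      \<open>q\<close> cannot disagree with \<open>r'\<close>.\<close>
    have "r' \<subseteq>\<^sub>m r' ++ q"
      unfolding map_le_def
    proof
      fix z assume z: "z \<in> dom r'"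
      have "z \<in> K \<times> UNIV" using imageI[OF z, of fst] r'(2) by (simp add: mem_Times_iff subset_iff)
      then have "q z = q' z" by (simp add: q'_def)
      moreover have "q' \<subseteq>\<^sub>m r'" using r'(1) by (simp add: cohen_iff)
      ultimately have "z \<in> dom q \<Longrightarrow> q z = r' z" by (metis domIff map_le_def)
      then show "r' z = (r' ++ q) z" by (cases "z \<in> dom q") (auto simp: map_add_def domIff split: option.splits)
    qed
    then have "agree r' q" unfolding agree_def by (intro exI[of _ "r' ++ q"]) simp
    then show "\<exists>r' A. ok (As @ [A]) r' \<and> agree r' q \<and>
        (\<exists>U. openin X U \<and> x \<in> X closure_of U \<and> (\<forall>y\<in>U. mem_pts y A (cohen \<kappa>) r'))"
      using ok' good by blast
  qed
  show ?thesis using is_play_play TWO_wins_play by blast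
qed

end

section \<open>The generic play refutes every winning strategy of ONE\<close>

theorem theorem18:
  fixes X :: "'a topology" and \<kappa> :: "'k rel"
  assumes "infinite (topspace X)"
    and "t1_space X"
    and "almost_Lindelof_space X"
    and "Card_order \<kappa>"
    and "uncountable (Field \<kappa>)"
  shows "forces (cohen \<kappa>) cohen_one
    (\<^bold>\<not> ONE_has_winning_strategy (check_points cohen_one X) (check_base cohen_one X))"
proof -
  interpret forcing_notion "cohen \<kappa>" cohen_one by (rule forcing_notion_cohen)
  let ?P = "cohen \<kappa>" and ?S = "check_points cohen_one X" and ?B = "check_base cohen_one X"
  have False if q: "(q, cohen_one) \<in> ?P" and ONE: "ONE_has_winning_strategy ?S ?B ?P q" for q
  proof -
    have qF: "q \<in> Field ?P" using q P_field by blast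
    \<comment> \<open>Strengthening \<open>q\<close> to \<open>p\<close> fixes a name
      \<open>F\<close> for the alleged winning strategy.\<close>
    from fExD[OF ONE[unfolded ONE_has_winning_strategy_def] P_refl[OF qF]] obtain p F
      where p: "(p, q) \<in> ?P" and F: "(is_strategy_ONE ?S ?B F \<^bold>\<and>
        (\<^bold>\<forall>T. is_play F T \<^bold>\<longrightarrow> \<^bold>\<not> TWO_wins ?S ?B T)) ?P p" by blast
    have pF: "p \<in> Field ?P" using p P_field by blast
    interpret cohen_strategy \<kappa> X F p
      by unfold_locales (use pF fAndD1[OF F] assms(3) in auto)
    have "topspace X \<noteq> {}" using assms(1) by auto
    then obtain T where T: "is_play F T ?P p" "TWO_wins ?S ?B T ?P p"
      using ex_winning_play assms(5) by blast
    have per: "persistent ?P (is_play F T)" "persistent ?P (\<^bold>\<not> TWO_wins ?S ?B T)"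
      unfolding is_play_def is_seq_def TWO_wins_def by (intro persistent_intros)+
    have "(\<^bold>\<not> TWO_wins ?S ?B T) ?P p"
      by (rule fImpD[OF per fAllD[OF fAndD2[OF F]] P_refl[OF pF] T(1)])
    then show False using T(2) P_refl[OF pF] unfolding fNot_def by blast
  qed
  then show ?thesis unfolding forces_def fNot_def by blast
qed

end
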